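(* Let $N,K,M$ be positive integers with $M\in[3:N]$ and $N=dM\pm1$ for some integer $d\ge2$. Then there exists a capacity-achieving linear $(\mu=M/N,N,K)$ SC-PIR scheme with sub-packetization $\left(d+\left\lceil\frac M2\right\rceil+1\right)(M-1)$ if $N=dM+1$, and with sub-packetization $\left(d+\left\lfloor\frac M2\right\rfloor+1\right)(M-1)$ if $N=dM-1$.
   Context: Notation: $[a:b]=\{a,a+1,\dots,b\}$; entropies are in base $q$, where $q$ is a fixed prime power; $A_{1:N}=(A_1,\dots,A_N)$. A $(\mu,N,K)$ SC-PIR (storage constrained private information retrieval) scheme consists of the following. Files: $W_1,\dots,W_K$ are independent and uniform on $\mathbb F_q^L$, for some file length $L\ge1$ (part of the scheme, free to be chosen). Storage: each file $W_k$ is partitioned into $F$ disjoint nonempty packets $W_{k,1},\dots,W_{k,F}$, with $H(W_{k,i})$ not depending on $k$; $F$ is the sub-packetization. Server $n\in[1:N]$ stores $Z_n=\{W_{k,i}:k\in[1:K],i\in\mathcal Z_n\}$ for some $\mathcal Z_n\subseteq[1:F]$, every $i\in[1:F]$ lies in at least one $\mathcal Z_n$, and $H(Z_n)\le\mu KL$ for all $n$. Retrieval: for each desired index $\theta\in[1:K]$ there are random queries $Q_{1:N}^{[\theta]}$ and answers $A_{1:N}^{[\theta]}$ with $I(Q_{1:N}^{[\theta]};W_{1:K})=0$; $H(A_n^{[\theta]}|Q_n^{[\theta]},Z_n)=0$ for all $n$; decodability $H(W_\theta|A_{1:N}^{[\theta]},Q_{1:N}^{[\theta]})=0$; and privacy: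 for every $n$, the distribution of $(Q_n^{[\theta]},A_n^{[\theta]},Z_n)$ does not depend on $\theta$. The average download cost over random queries is $D=\sum_{n=1}^N H(A_n^{[\theta]}|Q_n^{[\theta]})$ and the retrieval rate is $R=L/D$. For $M=\mu N\in[1:N]$ an integer the capacity (supremum of rates) is known to be $C^*=\left(1+\frac1M+\dots+\frac1{M^{K-1}}\right)^{-1}$; a scheme is capacity-achieving if $R=C^*$. The scheme is linear if each answer has the form $A_n^{[\theta]}=(\mathbf{LC}_{n,1}^{[\theta]}(Z_n),\dots,\mathbf{LC}_{n,\ell_n}^{[\theta]}(Z_n))$ with $\mathbf{LC}_{n,j}^{[\theta]}(Z_n)=\sum_{k\in[1:K]}\sum_{i\in\mathcal Z_n}\beta_{n,k,i,j}^{[\theta]}W_{k,i}$, where the length $\ell_n$ (possibly $0$, i.e. no answer) and the coefficients $\beta_{n,k,i,j}^{[\theta]}\in\mathbb F_q$ are determined by the query $Q_n^{[\theta]}$. Packets are vectors over $\mathbb F_q$; packets of different dimensions are added after zero-padding to the largest dimension. *)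

theory Defs
  imports "HOL-Probability.Probability" "HOL-Library.More_List"
begin

text \<open>
  The alphabet is a finite field \<open>'f\<close>, with \<open>q = CARD('f)\<close>.  All random variables of a scheme live
  on one probability space with sample type \<open>'s\<close>; queries have type \<open>'q\<close> and answers type \<open>'a\<close>.
  Files, packets, servers and desired indices are numbered from 1, the coordinates of a file from 0.
  A packet is given by the ordered list of the coordinates it consists of, so that it is a vector:
  packet \<open>i\<close> of file \<open>k\<close> consists of the coordinates \<open>packet_coords S k i\<close> of file \<open>k\<close>.
  The first argument of \<open>query\<close> and \<open>answer\<close> is the desired index, the second one is the server.
\<close>

record ('s, 'f, 'q, 'a) pir_scheme =
  sample :: "'s measure"
  file_length :: nat
  file_vec :: "nat \<Rightarrow> 's \<Rightarrow> 'f list"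
  subpacketization :: nat
  packet_coords :: "nat \<Rightarrow> nat \<Rightarrow> nat list"
  stored :: "nat \<Rightarrow> nat set"
  query :: "nat \<Rightarrow> nat \<Rightarrow> 's \<Rightarrow> 'q"
  answer :: "nat \<Rightarrow> nat \<Rightarrow> 's \<Rightarrow> 'a"

definition vectors :: "nat \<Rightarrow> 'f list set" where
  "vectors L = {v. length v = L}"

definition packet ::
  "('s, 'f, 'q, 'a) pir_scheme \<Rightarrow> nat \<Rightarrow> nat \<Rightarrow> 's \<Rightarrow> 'f list" where
  "packet S k i \<omega> = map (\<lambda>c. file_vec S k \<omega> ! c) (packet_coords S k i)"

definition all_files ::
  "('s, 'f, 'q, 'a) pir_scheme \<Rightarrow> nat \<Rightarrow> 's \<Rightarrow> nat \<Rightarrow> 'f list" where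
  "all_files S K \<omega> = restrict (\<lambda>k. file_vec S k \<omega>) {1..K}"

definition storage ::
  "('s, 'f, 'q, 'a) pir_scheme \<Rightarrow> nat \<Rightarrow> nat \<Rightarrow> 's \<Rightarrow> nat \<times> nat \<Rightarrow> 'f list" where
  "storage S K n \<omega> = restrict (\<lambda>(k, i). packet S k i \<omega>) ({1..K} \<times> stored S n)"

definition all_queries ::
  "('s, 'f, 'q, 'a) pir_scheme \<Rightarrow> nat \<Rightarrow> nat \<Rightarrow> 's \<Rightarrow> nat \<Rightarrow> 'q" where
  "all_queries S N \<theta> \<omega> = restrict (\<lambda>n. query S \<theta> n \<omega>) {1..N}"

definition all_answers ::
  "('s, 'f, 'q, 'a) pir_scheme \<Rightarrow> nat \<Rightarrow> nat \<Rightarrow> 's \<Rightarrow> nat \<Rightarrow> 'a" where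
  "all_answers S N \<theta> \<omega> = restrict (\<lambda>n. answer S \<theta> n \<omega>) {1..N}"

text \<open>
  Base-\<open>q\<close> information measures of random variables with finite range; these are the quantities
  which the locale \<^locale>\<open>information_space\<close> abbreviates for finite-range random variables.
\<close>

definition ent ::
  "('s, 'f::finite, 'q, 'a) pir_scheme \<Rightarrow> ('s \<Rightarrow> 'x) \<Rightarrow> real" where
  "ent S X = prob_space.entropy (sample S) (real CARD('f)) (count_space (X ` space (sample S))) X"

definition cond_ent ::
  "('s, 'f::finite, 'q, 'a) pir_scheme \<Rightarrow> ('s \<Rightarrow> 'x) \<Rightarrow> ('s \<Rightarrow> 'y) \<Rightarrow> real" where
  "cond_ent S X Y = prob_space.conditional_entropy (sample S) (real CARD('f))
     (count_space (X ` space (sample S))) (count_space (Y ` space (sample S))) X Y"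

definition mut_inf ::
  "('s, 'f::finite, 'q, 'a) pir_scheme \<Rightarrow> ('s \<Rightarrow> 'x) \<Rightarrow> ('s \<Rightarrow> 'y) \<Rightarrow> real" where
  "mut_inf S X Y = prob_space.mutual_information (sample S) (real CARD('f))
     (count_space (X ` space (sample S))) (count_space (Y ` space (sample S))) X Y"

definition files_uniform_independent ::
  "nat \<Rightarrow> ('s, 'f, 'q, 'a) pir_scheme \<Rightarrow> bool" where
  "files_uniform_independent K S \<longleftrightarrow>
     file_length S \<ge> 1 \<and>
     prob_space.indep_vars (sample S) (\<lambda>_. count_space (vectors (file_length S))) (file_vec S) {1..K} \<and>
     (\<forall>k\<in>{1..K}. distr (sample S) (count_space (vectors (file_length S))) (file_vec S k)
                = uniform_count_measure (vectors (file_length S)))"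

definition valid_packets ::
  "nat \<Rightarrow> ('s, 'f::finite, 'q, 'a) pir_scheme \<Rightarrow> bool" where
  "valid_packets K S \<longleftrightarrow>
     (\<forall>k\<in>{1..K}.
        (\<forall>i\<in>{1..subpacketization S}. packet_coords S k i \<noteq> [] \<and> distinct (packet_coords S k i)) \<and>
        disjoint_family_on (\<lambda>i. set (packet_coords S k i)) {1..subpacketization S} \<and>
        (\<Union>i\<in>{1..subpacketization S}. set (packet_coords S k i)) = {..<file_length S}) \<and>
     (\<forall>i\<in>{1..subpacketization S}. \<forall>k\<in>{1..K}. \<forall>k'\<in>{1..K}.
        ent S (packet S k i) = ent S (packet S k' i))"

definition valid_storage ::
  "real \<Rightarrow> nat \<Rightarrow> nat \<Rightarrow> ('s, 'f::finite, 'q, 'a) pir_scheme \<Rightarrow> bool" where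
  "valid_storage \<mu> N K S \<longleftrightarrow>
     (\<forall>n\<in>{1..N}. stored S n \<subseteq> {1..subpacketization S}) \<and>
     (\<forall>i\<in>{1..subpacketization S}. \<exists>n\<in>{1..N}. i \<in> stored S n) \<and>
     (\<forall>n\<in>{1..N}. ent S (storage S K n) \<le> \<mu> * real K * real (file_length S))"

definition valid_retrieval ::
  "nat \<Rightarrow> nat \<Rightarrow> ('s, 'f::finite, 'q, 'a) pir_scheme \<Rightarrow> bool" where
  "valid_retrieval N K S \<longleftrightarrow>
     (\<forall>\<theta>\<in>{1..K}.
        (\<forall>n\<in>{1..N}. simple_function (sample S) (query S \<theta> n) \<and>
                     simple_function (sample S) (answer S \<theta> n)) \<and>
        mut_inf S (all_queries S N \<theta>) (all_files S K) = 0 \<and>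
        (\<forall>n\<in>{1..N}. cond_ent S (answer S \<theta> n) (\<lambda>\<omega>. (query S \<theta> n \<omega>, storage S K n \<omega>)) = 0) \<and>
        cond_ent S (file_vec S \<theta>) (\<lambda>\<omega>. (all_answers S N \<theta> \<omega>, all_queries S N \<theta> \<omega>)) = 0)"

definition private_retrieval ::
  "nat \<Rightarrow> nat \<Rightarrow> ('s, 'f, 'q, 'a) pir_scheme \<Rightarrow> bool" where
  "private_retrieval N K S \<longleftrightarrow>
     (\<forall>n\<in>{1..N}. \<forall>\<theta>\<in>{1..K}. \<forall>\<theta>'\<in>{1..K}.
        distr (sample S) (count_space UNIV)
          (\<lambda>\<omega>. (query S \<theta> n \<omega>, answer S \<theta> n \<omega>, storage S K n \<omega>)) =
        distr (sample S) (count_space UNIV)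
          (\<lambda>\<omega>. (query S \<theta>' n \<omega>, answer S \<theta>' n \<omega>, storage S K n \<omega>)))"

definition sc_pir_scheme ::
  "real \<Rightarrow> nat \<Rightarrow> nat \<Rightarrow> ('s, 'f::finite, 'q, 'a) pir_scheme \<Rightarrow> bool" where
  "sc_pir_scheme \<mu> N K S \<longleftrightarrow>
     prob_space (sample S) \<and> files_uniform_independent K S \<and> valid_packets K S \<and>
     valid_storage \<mu> N K S \<and> valid_retrieval N K S \<and> private_retrieval N K S"

definition download_cost ::
  "nat \<Rightarrow> ('s, 'f::finite, 'q, 'a) pir_scheme \<Rightarrow> nat \<Rightarrow> real" where
  "download_cost N S \<theta> = (\<Sum>n\<in>{1..N}. cond_ent S (answer S \<theta> n) (query S \<theta> n))"

definition retrieval_rate ::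
  "nat \<Rightarrow> ('s, 'f::finite, 'q, 'a) pir_scheme \<Rightarrow> nat \<Rightarrow> real" where
  "retrieval_rate N S \<theta> = real (file_length S) / download_cost N S \<theta>"

definition pir_capacity :: "nat \<Rightarrow> nat \<Rightarrow> real" where
  "pir_capacity M K = inverse (\<Sum>m<K. 1 / real M ^ m)"

definition capacity_achieving ::
  "nat \<Rightarrow> nat \<Rightarrow> nat \<Rightarrow> ('s, 'f::finite, 'q, 'a) pir_scheme \<Rightarrow> bool" where
  "capacity_achieving M N K S \<longleftrightarrow>
     (\<forall>\<theta>\<in>{1..K}. retrieval_rate N S \<theta> = pir_capacity M K)"

text \<open>
  The linear combination of the packets stored at server \<open>n\<close> with coefficients \<open>\<beta> k i\<close>.  Its length
  is the largest dimension of a packet stored there; \<open>nth_default 0\<close> performs the zero-padding.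
\<close>

definition lin_comb ::
  "nat \<Rightarrow> ('s, 'f::field, 'q, 'a) pir_scheme \<Rightarrow> nat \<Rightarrow> (nat \<Rightarrow> nat \<Rightarrow> 'f) \<Rightarrow> 's \<Rightarrow> 'f list" where
  "lin_comb K S n \<beta> \<omega> =
     map (\<lambda>t. \<Sum>k\<in>{1..K}. \<Sum>i\<in>stored S n. \<beta> k i * nth_default 0 (packet S k i \<omega>) t)
       [0..<Max (insert 0 ((\<lambda>(k, i). length (packet_coords S k i)) ` ({1..K} \<times> stored S n)))]"

text \<open>
  The number \<open>l n x\<close> of combinations and their coefficients \<open>\<beta> n x k i j\<close> are determined by the
  query \<open>x\<close> received by server \<open>n\<close> alone; the server is not told the desired index.
\<close>

definition linear_scheme ::
  "nat \<Rightarrow> nat \<Rightarrow> ('s, 'f::field, 'q, 'f list list) pir_scheme \<Rightarrow> bool" where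
  "linear_scheme N K S \<longleftrightarrow>
     (\<exists>(l :: nat \<Rightarrow> 'q \<Rightarrow> nat) (\<beta> :: nat \<Rightarrow> 'q \<Rightarrow> nat \<Rightarrow> nat \<Rightarrow> nat \<Rightarrow> 'f).
        \<forall>\<theta>\<in>{1..K}. \<forall>n\<in>{1..N}. \<forall>\<omega>\<in>space (sample S).
          answer S \<theta> n \<omega> =
            map (\<lambda>j. lin_comb K S n (\<lambda>k i. \<beta> n (query S \<theta> n \<omega>) k i j) \<omega>)
              [1..<l n (query S \<theta> n \<omega>) + 1])"

text \<open>
  Linear schemes whose sample points are pairs of the files and the private randomness of the user.
  The randomness and the queries may be any finite data, encoded as lists of natural numbers.
\<close>

type_synonym 'f linear_pir_scheme =
  "((nat \<Rightarrow> 'f list) \<times> nat list, 'f, nat list, 'f list list) pir_scheme"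

end

theory Submission
  imports Defs
begin

text \<open>
  Distribute the packets over blocks of \<open>M\<close> servers, where block \<open>b\<close> carries \<open>M - 1\<close> packets of
  dimension \<open>w b\<close> of every file, and run in every block, with independent randomness, the
  capacity-achieving scheme for \<open>M\<close> fully replicated servers: the user draws a vector over
  \<open>\<int>/M\<close> with coordinate sum 0, the server at position \<open>j\<close> receives this vector with \<open>j\<close> added
  to the desired coordinate, and it returns the sum of the packets selected by the coordinates, 0
  selecting nothing. A query at position \<open>j\<close> is uniform among the vectors with sum \<open>j\<close>, whatever
  the desired index; a server is idle only for the zero vector, which needs \<open>j = 0\<close> and has
  probability \<open>1 / M^(K - 1)\<close>, so that \<open>M - 1 / M^(K - 1)\<close> combinations per block are downloaded on
  average.

  The storage constraint says that the weights of the blocks through each of the \<open>N\<close> servers add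
  up to the same number, here \<open>M\<close> (and then all weights add up to \<open>N\<close>). Adding a disjoint block of
  weight \<open>M\<close> raises \<open>N\<close> by \<open>M\<close>, and complementing all blocks replaces \<open>M\<close> by \<open>N - M\<close>; this
  reduces both cases to \<open>N = 2 * m + 1\<close> with blocks of size \<open>m\<close>, where \<open>(m + 1) div 2 + 3\<close> blocks
  suffice.
\<close>

section \<open>Entropy on finite uniform spaces\<close>

lemma information_space_uniform:
  assumes "finite \<Omega>" "\<Omega> \<noteq> {}" "1 < b"
  shows "information_space (uniform_count_measure \<Omega>) b"
proof -
  interpret prob_space "uniform_count_measure \<Omega>"
    by (rule prob_space_uniform_count_measure) fact+
  show ?thesis
    by unfold_locales (rule \<open>1 < b\<close>)
qed

lemma simple_function_uniform:
  "finite \<Omega> \<Longrightarrow> simple_function (uniform_count_measure \<Omega>) X"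
  by (auto simp: simple_function_def space_uniform_count_measure sets_uniform_count_measure)

text \<open>Every probability on the uniform space is the size of such a fibre divided by
  \<open>card \<Omega>\<close>, which reduces entropies to counting.\<close>

definition fibre :: "'s set \<Rightarrow> ('s \<Rightarrow> 'x) \<Rightarrow> 'x \<Rightarrow> 's set" where
  "fibre \<Omega> X x = {\<omega> \<in> \<Omega>. X \<omega> = x}"

lemma simple_distributed_uniform:
  assumes "finite \<Omega>" "\<Omega> \<noteq> {}"
  shows "simple_distributed (uniform_count_measure \<Omega>) X
           (\<lambda>x. real (card (fibre \<Omega> X x)) / real (card \<Omega>))"
proof (rule prob_space.simple_distributedI)
  show "prob_space (uniform_count_measure \<Omega>)"
    using assms by (rule prob_space_uniform_count_measure)
  show "simple_function (uniform_count_measure \<Omega>) X"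
    using assms(1) by (rule simple_function_uniform)
  fix x
  have "X -` {x} \<inter> \<Omega> = fibre \<Omega> X x"
    by (auto simp: fibre_def)
  then show "real (card (fibre \<Omega> X x)) / real (card \<Omega>) =
      measure (uniform_count_measure \<Omega>) (X -` {x} \<inter> space (uniform_count_measure \<Omega>))"
    using assms by (simp add: measure_uniform_count_measure space_uniform_count_measure fibre_def)
qed simp

text \<open>Each value \<open>(x, y)\<close> enters with the number of sample points that take it,
  so the sum over values becomes an average over sample points of the logarithm of a ratio of fibre
  sizes. In this form the entropy can be evaluated as soon as the ratios are known
  pointwise.\<close>

lemma conditional_entropy_uniform:
  assumes "finite \<Omega>" "\<Omega> \<noteq> {}" "1 < b"
  shows "prob_space.conditional_entropy (uniform_count_measure \<Omega>) b
           (count_space (X ` \<Omega>)) (count_space (Y ` \<Omega>)) X Y =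
         (\<Sum>\<omega>\<in>\<Omega>. log b (real (card (fibre \<Omega> Y (Y \<omega>))) /
             real (card (fibre \<Omega> (\<lambda>\<omega>. (X \<omega>, Y \<omega>)) (X \<omega>, Y \<omega>))))) / real (card \<Omega>)"
proof -
  interpret information_space "uniform_count_measure \<Omega>" b
    using assms by (rule information_space_uniform)
  let ?XY = "\<lambda>\<omega>. (X \<omega>, Y \<omega>)"
  let ?c = "\<lambda>x y. real (card (fibre \<Omega> ?XY (x, y)))"
  let ?d = "\<lambda>y. real (card (fibre \<Omega> Y y))"
  let ?n = "real (card \<Omega>)"
  have n: "?n > 0"
    using assms by (simp add: card_gt_0_iff)
  have "conditional_entropy b (count_space (X ` \<Omega>)) (count_space (Y ` \<Omega>)) X Y =
      - (\<Sum>(x, y)\<in>?XY ` \<Omega>. ?c x y / ?n * log b (?c x y / ?n / (?d y / ?n)))"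
    using conditional_entropy_eq[OF simple_distributed_uniform[OF assms(1,2)]
        simple_distributed_uniform[OF assms(1,2)], of X Y]
    by (simp add: space_uniform_count_measure case_prod_unfold)
  also have "\<dots> = (\<Sum>p\<in>?XY ` \<Omega>. ?c (fst p) (snd p) * log b (?d (snd p) / ?c (fst p) (snd p))) / ?n"
    unfolding sum_negf[symmetric] sum_divide_distrib
  proof (rule sum.cong[OF refl])
    fix p assume "p \<in> ?XY ` \<Omega>"
    then obtain \<omega> where \<omega>: "\<omega> \<in> \<Omega>" "p = (X \<omega>, Y \<omega>)" by auto
    have "\<omega> \<in> fibre \<Omega> ?XY p" "\<omega> \<in> fibre \<Omega> Y (snd p)"
      using \<omega> by (auto simp: fibre_def)
    moreover have "finite (fibre \<Omega> ?XY p)" "finite (fibre \<Omega> Y (snd p))"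
      using assms(1) by (auto simp: fibre_def)
    ultimately have "?c (fst p) (snd p) > 0" "?d (snd p) > 0"
      using \<omega> by (auto simp: card_gt_0_iff)
    then show "- (case p of (x, y) \<Rightarrow> ?c x y / ?n * log b (?c x y / ?n / (?d y / ?n))) =
        ?c (fst p) (snd p) * log b (?d (snd p) / ?c (fst p) (snd p)) / ?n"
      using n
      by (simp add: case_prod_unfold log_divide minus_divide_left mult_minus_right[symmetric]
          del: mult_minus_right)
  qed
  also have "(\<Sum>p\<in>?XY ` \<Omega>. ?c (fst p) (snd p) * log b (?d (snd p) / ?c (fst p) (snd p))) =
      (\<Sum>p\<in>?XY ` \<Omega>. \<Sum>\<omega>\<in>{\<omega>\<in>\<Omega>. ?XY \<omega> = p}. log b (?d (Y \<omega>) / ?c (X \<omega>) (Y \<omega>)))"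
    by (intro sum.cong) (auto simp: fibre_def)
  also have "\<dots> = (\<Sum>\<omega>\<in>\<Omega>. log b (?d (Y \<omega>) / ?c (X \<omega>) (Y \<omega>)))"
    using assms(1) by (rule sum.image_gen[symmetric])
  finally show ?thesis .
qed

lemma conditional_entropy_uniform_eq_0:
  assumes "finite \<Omega>" "\<Omega> \<noteq> {}" "1 < b"
    and det: "\<And>\<omega> \<omega>'. \<omega> \<in> \<Omega> \<Longrightarrow> \<omega>' \<in> \<Omega> \<Longrightarrow> Y \<omega> = Y \<omega>' \<Longrightarrow> X \<omega> = X \<omega>'"
  shows "prob_space.conditional_entropy (uniform_count_measure \<Omega>) b
           (count_space (X ` \<Omega>)) (count_space (Y ` \<Omega>)) X Y = 0"
proof -
  have "fibre \<Omega> (\<lambda>\<omega>. (X \<omega>, Y \<omega>)) (X \<omega>, Y \<omega>) = fibre \<Omega> Y (Y \<omega>)" if "\<omega> \<in> \<Omega>" for \<omega>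
    unfolding fibre_def using det that by blast
  \<comment> \<open>A ratio of equal fibre sizes simplifies to \<open>if P then 0 else 1\<close>;
    both branches have logarithm 0, since \<open>log b 0 = 0\<close> by convention.\<close>
  moreover have "log b (if P then 0 else 1) = 0" for P
    by (simp add: log_def)
  ultimately show ?thesis
    by (subst conditional_entropy_uniform[OF assms(1-3)]) simp
qed

text \<open>The factors of a product with uniform measure are independent: a joint fibre is the
  product of a fibre of \<open>f\<close> and one of \<open>g\<close>. Files and user randomness will
  be the two factors.\<close>

lemma mutual_information_uniform_eq_0:
  assumes "finite A" "A \<noteq> {}" "finite C" "C \<noteq> {}" "1 < b"
    and X: "\<And>a c. a \<in> A \<Longrightarrow> c \<in> C \<Longrightarrow> X (a, c) = f a"
    and Y: "\<And>a c. a \<in> A \<Longrightarrow> c \<in> C \<Longrightarrow> Y (a, c) = g c"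
  shows "prob_space.mutual_information (uniform_count_measure (A \<times> C)) b
           (count_space (Y ` (A \<times> C))) (count_space (X ` (A \<times> C))) Y X = 0"
proof -
  have fin: "finite (A \<times> C)" "A \<times> C \<noteq> {}" using assms by auto
  interpret information_space "uniform_count_measure (A \<times> C)" b
    using fin assms(5) by (rule information_space_uniform)
  note sd = simple_distributed_uniform[OF fin]
  have "mutual_information b (count_space (Y ` space (uniform_count_measure (A \<times> C))))
      (count_space (X ` space (uniform_count_measure (A \<times> C)))) Y X = 0"
  proof (rule mutual_information_eq_0_simple[OF sd sd sd], rule ballI)
    fix \<omega> assume "\<omega> \<in> space (uniform_count_measure (A \<times> C))"
    then obtain a c where \<omega>: "\<omega> = (a, c)" "a \<in> A" "c \<in> C"
      by (auto simp: space_uniform_count_measure)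
    have "fibre (A \<times> C) (\<lambda>\<omega>. (Y \<omega>, X \<omega>)) (g c, f a) = fibre A f (f a) \<times> fibre C g (g c)"
      "fibre (A \<times> C) Y (g c) = A \<times> fibre C g (g c)"
      "fibre (A \<times> C) X (f a) = fibre A f (f a) \<times> C"
      by (auto simp: fibre_def X Y)
    then show "real (card (fibre (A \<times> C) (\<lambda>\<omega>. (Y \<omega>, X \<omega>)) (Y \<omega>, X \<omega>))) / real (card (A \<times> C)) =
        real (card (fibre (A \<times> C) Y (Y \<omega>))) / real (card (A \<times> C)) *
        (real (card (fibre (A \<times> C) X (X \<omega>))) / real (card (A \<times> C)))"
      using \<omega> X Y assms by (simp add: card_cartesian_product mult.commute)
  qed
  then show ?thesis by (simp add: space_uniform_count_measure)
qed

text \<open>A bijection carries one uniform measure to the other, since preimages keep their size.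
  The privacy proof uses it with two different spaces.\<close>

lemma distr_uniform_bij_betw:
  assumes "finite \<Omega>" "bij_betw \<tau> \<Omega> \<Omega>'" "\<And>\<omega>. \<omega> \<in> \<Omega> \<Longrightarrow> X \<omega> = Y (\<tau> \<omega>)"
    and V: "Y ` \<Omega>' \<subseteq> V"
  shows "distr (uniform_count_measure \<Omega>) (count_space V) X =
         distr (uniform_count_measure \<Omega>') (count_space V) Y"
proof (rule measure_eqI)
  fix B assume "B \<in> sets (distr (uniform_count_measure \<Omega>) (count_space V) X)"
  then have B: "B \<subseteq> V" by simp
  have fin': "finite \<Omega>'"
    using assms(1,2) bij_betw_finite by blast
  have im: "\<tau> ` \<Omega> = \<Omega>'" and inj: "inj_on \<tau> \<Omega>"
    using assms(2) by (auto simp: bij_betw_def)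
  have XV: "X ` \<Omega> \<subseteq> V"
  proof
    fix x assume "x \<in> X ` \<Omega>"
    then obtain \<omega> where \<omega>: "\<omega> \<in> \<Omega>" "x = X \<omega>" by blast
    then have "x = Y (\<tau> \<omega>)" "\<tau> \<omega> \<in> \<Omega>'"
      using assms(3) im by auto
    then show "x \<in> V" using V by blast
  qed
  have "\<tau> ` (X -` B \<inter> \<Omega>) = Y -` B \<inter> \<Omega>'"
    unfolding im[symmetric]
  proof (intro equalityI subsetI)
    fix y assume "y \<in> \<tau> ` (X -` B \<inter> \<Omega>)"
    then obtain \<omega> where "\<omega> \<in> \<Omega>" "X \<omega> \<in> B" "y = \<tau> \<omega>" by blast
    then show "y \<in> Y -` B \<inter> \<tau> ` \<Omega>"
      by (simp add: assms(3)[symmetric])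
  next
    fix y assume "y \<in> Y -` B \<inter> \<tau> ` \<Omega>"
    then obtain \<omega> where \<omega>: "\<omega> \<in> \<Omega>" "Y y \<in> B" "y = \<tau> \<omega>" by blast
    then have "X \<omega> \<in> B"
      by (simp add: assms(3))
    with \<omega> show "y \<in> \<tau> ` (X -` B \<inter> \<Omega>)"
      by blast
  qed
  then have "card (Y -` B \<inter> \<Omega>') = card (X -` B \<inter> \<Omega>)"
    using card_image[OF inj_on_subset[OF inj, of "X -` B \<inter> \<Omega>"]] by simp
  moreover have "card \<Omega>' = card \<Omega>"
    using bij_betw_same_card[OF assms(2)] by simp
  moreover have "X \<in> uniform_count_measure \<Omega> \<rightarrow>\<^sub>M count_space V"
    using XV by (auto simp: measurable_def space_uniform_count_measure sets_uniform_count_measure)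
  moreover have "Y \<in> uniform_count_measure \<Omega>' \<rightarrow>\<^sub>M count_space V"
    using V by (auto simp: measurable_def space_uniform_count_measure sets_uniform_count_measure)
  ultimately show "emeasure (distr (uniform_count_measure \<Omega>) (count_space V) X) B =
      emeasure (distr (uniform_count_measure \<Omega>') (count_space V) Y) B"
    using B assms(1) fin'
    by (simp add: emeasure_distr emeasure_uniform_count_measure space_uniform_count_measure)
qed simp

lemma entropy_uniform_bij_betw:
  assumes "finite \<Omega>" "\<Omega> \<noteq> {}" "bij_betw \<tau> \<Omega> \<Omega>" "\<And>\<omega>. \<omega> \<in> \<Omega> \<Longrightarrow> X \<omega> = Y (\<tau> \<omega>)"
  shows "prob_space.entropy (uniform_count_measure \<Omega>) b (count_space (X ` \<Omega>)) X =
         prob_space.entropy (uniform_count_measure \<Omega>) b (count_space (Y ` \<Omega>)) Y"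
proof -
  interpret prob_space "uniform_count_measure \<Omega>"
    by (rule prob_space_uniform_count_measure) fact+
  have "X ` \<Omega> = Y ` \<tau> ` \<Omega>"
    unfolding image_image by (rule image_cong[OF refl assms(4)])
  then have "X ` \<Omega> = Y ` \<Omega>"
    using assms(3) by (simp add: bij_betw_def)
  moreover have "distr (uniform_count_measure \<Omega>) (count_space (Y ` \<Omega>)) X =
      distr (uniform_count_measure \<Omega>) (count_space (Y ` \<Omega>)) Y"
    using assms(1,3)
    by (rule distr_uniform_bij_betw) (simp_all add: assms(4))
  ultimately show ?thesis
    by (simp add: entropy_def)
qed

lemma entropy_uniform_le:
  assumes "finite \<Omega>" "\<Omega> \<noteq> {}" "1 < b" "card (X ` \<Omega>) \<le> c"
  shows "prob_space.entropy (uniform_count_measure \<Omega>) b (count_space (X ` \<Omega>)) X \<le> log b (real c)"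
proof -
  interpret information_space "uniform_count_measure \<Omega>" b
    using assms(1-3) by (rule information_space_uniform)
  have "entropy b (count_space (X ` \<Omega>)) X \<le> log b (real (card (X ` \<Omega>)))"
    using entropy_le_card[OF simple_distributed_uniform[OF assms(1,2)], of X]
    by (simp add: space_uniform_count_measure)
  also have "\<dots> \<le> log b (real c)"
  proof -
    have "0 < card (X ` \<Omega>)" using assms by (simp add: card_gt_0_iff)
    then show ?thesis using assms(3,4) by simp
  qed
  finally show ?thesis .
qed

text \<open>The event that the coordinates in \<open>J\<close> lie in given sets is a box, so its
  size factors. The factor \<open>C\<close> carries the randomness of the user and cancels from
  every probability.\<close>

lemma indep_vars_uniform_PiE:
  assumes I: "finite I" "I \<noteq> {}" and V: "finite V" "V \<noteq> {}" and C: "finite C" "C \<noteq> {}"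
  defines "P \<equiv> uniform_count_measure ((I \<rightarrow>\<^sub>E V) \<times> C)"
  shows "prob_space.indep_vars P (\<lambda>_. count_space V) (\<lambda>i \<omega>. fst \<omega> i) I \<and>
    (\<forall>i\<in>I. distr P (count_space V) (\<lambda>\<omega>. fst \<omega> i) = uniform_count_measure V)"
proof -
  let ?\<Omega> = "(I \<rightarrow>\<^sub>E V) \<times> C"
  have fin: "finite ?\<Omega>" "?\<Omega> \<noteq> {}"
    using assms by (auto intro!: finite_PiE simp: PiE_eq_empty_iff)
  interpret prob_space P
    unfolding P_def using fin by (rule prob_space_uniform_count_measure)
  have [simp]: "space P = ?\<Omega>" "sets P = Pow ?\<Omega>"
    by (simp_all add: P_def space_uniform_count_measure sets_uniform_count_measure)
  have card\<Omega>: "card ?\<Omega> = card V ^ card I * card C"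
    using I by (simp add: card_cartesian_product card_PiE)
  have pos: "card V > 0" "card C > 0"
    using V C by (auto simp: card_gt_0_iff)
  have rv: "random_variable (count_space V) (\<lambda>\<omega>. fst \<omega> i)" if "i \<in> I" for i
    using that by (auto simp: measurable_def)
  have prob: "prob {\<omega>\<in>?\<Omega>. \<forall>j\<in>J. fst \<omega> j \<in> A j} = (\<Prod>j\<in>J. real (card (A j)) / real (card V))"
    if J: "J \<subseteq> I" and A: "\<And>j. j \<in> J \<Longrightarrow> A j \<subseteq> V" for J A
  proof -
    \<comment> \<open>Coordinates outside \<open>J\<close> are unconstrained, so their side of the
      box is all of \<open>V\<close>.\<close>
    have "{\<omega>\<in>?\<Omega>. \<forall>j\<in>J. fst \<omega> j \<in> A j} = (\<Pi>\<^sub>E i\<in>I. if i \<in> J then A i else V) \<times> C"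
    proof -
      have "(\<forall>i\<in>I. f i \<in> V) \<and> (\<forall>j\<in>J. f j \<in> A j) \<longleftrightarrow> (\<forall>i\<in>I. f i \<in> (if i \<in> J then A i else V))" for f
        using J A by (auto dest: subsetD)
      then have "(f \<in> (\<Pi>\<^sub>E i\<in>I. if i \<in> J then A i else V)) =
          (f \<in> I \<rightarrow>\<^sub>E V \<and> (\<forall>j\<in>J. f j \<in> A j))" for f
        unfolding PiE_iff by blast
      then show ?thesis
        by (simp only: set_eq_iff mem_Times_iff mem_Collect_eq) blast
    qed
    moreover have "card (\<Pi>\<^sub>E i\<in>I. if i \<in> J then A i else V) = (\<Prod>j\<in>J. card (A j)) * card V ^ card (I - J)"
    proof -
      have "(\<Prod>i\<in>I. card (if i \<in> J then A i else V)) =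
          (\<Prod>i\<in>I - J. card (if i \<in> J then A i else V)) * (\<Prod>i\<in>J. card (if i \<in> J then A i else V))"
        using I J by (intro prod.subset_diff) auto
      then show ?thesis
        using I by (simp add: card_PiE mult.commute)
    qed
    moreover have "card I = card J + card (I - J)"
      using I J by (metis card_Diff_subset card_mono finite_subset le_add_diff_inverse)
    ultimately have "prob {\<omega>\<in>?\<Omega>. \<forall>j\<in>J. fst \<omega> j \<in> A j} =
        real ((\<Prod>j\<in>J. card (A j)) * card V ^ card (I - J) * card C) /
        real (card V ^ (card J + card (I - J)) * card C)"
      unfolding P_def using fin card\<Omega>
      by (subst measure_uniform_count_measure) (auto simp: card_cartesian_product)
    then show ?thesis
      using pos by (simp add: prod_dividef power_add)
  qed
  have "indep_vars (\<lambda>_. count_space V) (\<lambda>i \<omega>. fst \<omega> i) I"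
    unfolding indep_vars_def2
  proof (intro conjI ballI rv indep_setsI)
    fix i assume "i \<in> I"
    show "{(\<lambda>\<omega>. fst \<omega> i) -` A \<inter> space P |A. A \<in> sets (count_space V)} \<subseteq> events"
      by auto
  next
    fix E J assume J: "J \<noteq> {}" "J \<subseteq> I" "finite J"
      and E: "\<forall>j\<in>J. E j \<in> {(\<lambda>\<omega>. fst \<omega> j) -` A \<inter> space P |A. A \<in> sets (count_space V)}"
    have "\<exists>A\<subseteq>V. E j = {\<omega>\<in>?\<Omega>. fst \<omega> j \<in> A}" if j: "j \<in> J" for j
    proof -
      obtain A where "A \<subseteq> V" "E j = (\<lambda>\<omega>. fst \<omega> j) -` A \<inter> ?\<Omega>"
        using bspec[OF E j] unfolding mem_Collect_eq sets_count_space \<open>space P = ?\<Omega>\<close> by blast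
      then show ?thesis by (intro exI[of _ A]) blast
    qed
    then have "\<forall>j\<in>J. \<exists>A. A \<subseteq> V \<and> E j = {\<omega>\<in>?\<Omega>. fst \<omega> j \<in> A}"
      by blast
    then have "\<exists>A. \<forall>j\<in>J. A j \<subseteq> V \<and> E j = {\<omega>\<in>?\<Omega>. fst \<omega> j \<in> A j}"
      by (rule bchoice)
    then obtain A where "\<forall>j\<in>J. A j \<subseteq> V \<and> E j = {\<omega>\<in>?\<Omega>. fst \<omega> j \<in> A j}" ..
    then have A: "j \<in> J \<Longrightarrow> A j \<subseteq> V \<and> E j = {\<omega>\<in>?\<Omega>. fst \<omega> j \<in> A j}" for j
      by (rule bspec)
    have "\<Inter> (E ` J) = {\<omega>\<in>?\<Omega>. \<forall>j\<in>J. fst \<omega> j \<in> A j}"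
    proof (intro equalityI subsetI)
      fix \<omega> assume \<omega>: "\<omega> \<in> \<Inter> (E ` J)"
      then have "\<omega> \<in> {\<omega>\<in>?\<Omega>. fst \<omega> j \<in> A j}" if "j \<in> J" for j
        using that A by blast
      then show "\<omega> \<in> {\<omega>\<in>?\<Omega>. \<forall>j\<in>J. fst \<omega> j \<in> A j}"
        using J(1) by blast
    next
      fix \<omega> assume "\<omega> \<in> {\<omega>\<in>?\<Omega>. \<forall>j\<in>J. fst \<omega> j \<in> A j}"
      then have "\<omega> \<in> {\<omega>\<in>?\<Omega>. fst \<omega> j \<in> A j}" if "j \<in> J" for j
        using that by blast
      then show "\<omega> \<in> \<Inter> (E ` J)"
        using A by blast
    qed
    then have "prob (\<Inter> (E ` J)) = (\<Prod>j\<in>J. real (card (A j)) / real (card V))"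
      using prob[OF J(2)] A by simp
    also have "\<dots> = (\<Prod>j\<in>J. prob (E j))"
    proof (rule prod.cong[OF refl])
      fix j assume j: "j \<in> J"
      then show "real (card (A j)) / real (card V) = prob (E j)"
        using prob[of "{j}" A] A[OF j] subsetD[OF J(2) j] by simp
    qed
    finally show "prob (\<Inter> (E ` J)) = (\<Prod>j\<in>J. prob (E j))" .
  qed
  moreover have "distr P (count_space V) (\<lambda>\<omega>. fst \<omega> i) = uniform_count_measure V"
    if i: "i \<in> I" for i
  proof (rule measure_eqI)
    fix B assume "B \<in> sets (distr P (count_space V) (\<lambda>\<omega>. fst \<omega> i))"
    then have B: "B \<subseteq> V" by simp
    have "(\<lambda>\<omega>. fst \<omega> i) -` B \<inter> space P = {\<omega>\<in>?\<Omega>. \<forall>j\<in>{i}. fst \<omega> j \<in> B}"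
      by auto
    then have "emeasure (distr P (count_space V) (\<lambda>\<omega>. fst \<omega> i)) B =
        ennreal (prob {\<omega>\<in>?\<Omega>. \<forall>j\<in>{i}. fst \<omega> j \<in> B})"
      using B rv[OF i] by (simp add: emeasure_distr emeasure_eq_measure)
    also have "\<dots> = emeasure (uniform_count_measure V) B"
      using B V i prob[of "{i}" "\<lambda>_. B"] by (simp add: emeasure_uniform_count_measure)
    finally show "emeasure (distr P (count_space V) (\<lambda>\<omega>. fst \<omega> i)) B =
        emeasure (uniform_count_measure V) B" .
  qed (simp add: sets_uniform_count_measure)
  ultimately show ?thesis by blast
qed

lemma card_field_gt_1: "1 < real CARD('f::{finite,field})"
proof -
  have "card {0, 1 :: 'f} \<le> CARD('f)" by (rule card_mono) auto
  then show ?thesis by simp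
qed

section \<open>The scheme of a block design\<close>

text \<open>\<open>pos b\<close> numbers the \<open>M\<close> servers of block \<open>b\<close> from
  0. With \<open>M - 1\<close> packets of dimension \<open>w b\<close> in block \<open>b\<close>,
  \<open>weight\<close> makes a file \<open>N * (M - 1)\<close> coordinates long and
  \<open>load\<close> makes each server hold \<open>M * (M - 1)\<close> of them, exactly the
  fraction \<open>M / N\<close>.\<close>

locale block_code =
  fixes N M K B :: nat and blk :: "nat \<Rightarrow> nat set" and w :: "nat \<Rightarrow> nat" and pos :: "nat \<Rightarrow> nat \<Rightarrow> nat"
  assumes K: "1 \<le> K" and M: "2 \<le> M" and N: "1 \<le> N"
    and blk: "b < B \<Longrightarrow> blk b \<subseteq> {1..N}"
    and w_pos: "b < B \<Longrightarrow> 0 < w b"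
    and pos: "b < B \<Longrightarrow> bij_betw (pos b) (blk b) {..<M}"
    and load: "n \<in> {1..N} \<Longrightarrow> (\<Sum>b<B. if n \<in> blk b then w b else 0) = M"
    and weight: "(\<Sum>b<B. w b) = N"
begin

section \<open>Numbering of packets and coordinates\<close>

definition F :: nat where "F = B * (M - 1)"
definition L :: nat where "L = N * (M - 1)"
definition block_of :: "nat \<Rightarrow> nat" where "block_of i = (i - 1) div (M - 1)"
text \<open>Packets are numbered block by block; within a block they are 1 to \<open>M - 1\<close>,
  which leaves 0 free as the query entry that selects nothing.\<close>

definition sub_of :: "nat \<Rightarrow> nat" where "sub_of i = Suc ((i - 1) mod (M - 1))"
definition idx :: "nat \<Rightarrow> nat \<Rightarrow> nat" where "idx b s = b * (M - 1) + s"
text \<open>The packets of a file are laid end to end; packet \<open>i\<close> starts at this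
  coordinate, counted from 0.\<close>

definition off :: "nat \<Rightarrow> nat" where "off i = (\<Sum>i'\<in>{1..<i}. w (block_of i'))"

lemma idx_mem:
  assumes "b < B" "0 < s" "s < M"
  shows "idx b s \<in> {1..F}"
proof -
  have "b * (M - 1) + s \<le> Suc b * (M - 1)"
    using assms by simp
  also have "\<dots> \<le> B * (M - 1)"
    using assms by (intro mult_le_mono1) simp
  finally show ?thesis
    using assms by (simp add: idx_def F_def)
qed

lemma block_of_idx:
  assumes "0 < s" "s < M"
  shows "block_of (idx b s) = b"
proof -
  obtain s' where "s = Suc s'" "s' < M - 1"
    using assms by (cases s) auto
  then show ?thesis
    by (simp add: idx_def block_of_def)
qed

lemma sub_of_idx:
  assumes "0 < s" "s < M"
  shows "sub_of (idx b s) = s"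
proof -
  obtain s' where "s = Suc s'" "s' < M - 1"
    using assms by (cases s) auto
  then show ?thesis
    by (simp add: idx_def sub_of_def)
qed

lemma block_of_less: "i \<in> {1..F} \<Longrightarrow> block_of i < B"
  by (auto simp: F_def block_of_def intro!: less_mult_imp_div_less)

lemma sub_of_pos: "0 < sub_of i"
  by (simp add: sub_of_def)

lemma sub_of_less: "sub_of i < M"
proof -
  have "(i - 1) mod (M - 1) < M - 1"
    using M by (intro mod_less_divisor) simp
  then show ?thesis
    by (simp add: sub_of_def)
qed

lemma idx_block_of_sub_of:
  assumes "i \<in> {1..F}"
  shows "idx (block_of i) (sub_of i) = i"
proof -
  have "idx (block_of i) (sub_of i) = Suc (i - 1)"
    unfolding idx_def block_of_def sub_of_def add_Suc_right div_mult_mod_eq ..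
  then show ?thesis
    using assms by simp
qed

text \<open>Consecutive groups of \<open>M - 1\<close> packets share a block. Applied to
  \<open>w\<close> this gives the file length, applied to \<open>w\<close> on the blocks of one
  server its storage.\<close>

lemma sum_block_of:
  fixes g :: "nat \<Rightarrow> nat"
  shows "(\<Sum>i\<in>{1..F}. g (block_of i)) = (M - 1) * (\<Sum>b<B. g b)"
proof -
  have "(\<Sum>i\<in>{1..F}. g (block_of i)) = (\<Sum>i<B * (M - 1). g (block_of (Suc i)))"
    unfolding F_def by (rule sum.reindex_bij_witness[of _ Suc "\<lambda>i. i - 1"]) auto
  also have "\<dots> = (\<Sum>b<B. \<Sum>i\<in>{b * (M - 1)..<b * (M - 1) + (M - 1)}. g (block_of (Suc i)))"
    by (rule sum.nat_group[symmetric])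
  also have "\<dots> = (\<Sum>b<B. (M - 1) * g b)"
  proof (rule sum.cong[OF refl])
    fix b assume "b \<in> {..<B}"
    have "block_of (Suc i) = b" if i: "i \<in> {b * (M - 1)..<b * (M - 1) + (M - 1)}" for i
    proof -
      obtain j where "i = b * (M - 1) + j"
        using i le_Suc_ex[of "b * (M - 1)" i] by auto
      with i show ?thesis by (simp add: block_of_def)
    qed
    then show "(\<Sum>i\<in>{b * (M - 1)..<b * (M - 1) + (M - 1)}. g (block_of (Suc i))) = (M - 1) * g b"
      by simp
  qed
  finally show ?thesis by (simp add: sum_distrib_left)
qed

lemma off_Suc: "1 \<le> i \<Longrightarrow> off (Suc i) = off i + w (block_of i)"
  by (simp add: off_def)

lemma off_1: "off (Suc 0) = 0"
  by (simp add: off_def)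

lemma off_last: "off (Suc F) = L"
proof -
  have "off (Suc F) = (\<Sum>i\<in>{1..F}. w (block_of i))"
    by (simp add: off_def atLeastLessThanSuc_atLeastAtMost)
  then show ?thesis
    unfolding sum_block_of weight by (simp add: L_def mult.commute)
qed

lemma off_mono: "i \<le> j \<Longrightarrow> off i \<le> off j"
  unfolding off_def by (intro sum_mono2) auto

text \<open>Packets occupy disjoint intervals: for \<open>i < j\<close> the interval of
  \<open>i\<close> ends by \<open>off j\<close>, so a common coordinate is impossible.\<close>

lemma off_inj:
  assumes "1 \<le> i" "1 \<le> j" "t < w (block_of i)" "u < w (block_of j)" "off i + t = off j + u"
  shows "i = j"
proof (rule linorder_cases)
  assume "i < j"
  then have "off (Suc i) \<le> off j" by (intro off_mono) simp
  then show ?thesis using assms by (simp add: off_Suc)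
next
  assume "j < i"
  then have "off (Suc j) \<le> off i" by (intro off_mono) simp
  then show ?thesis using assms by (simp add: off_Suc)
qed

lemma off_cover: "(\<Union>i\<in>{1..n}. {off i..<off (Suc i)}) = {..<off (Suc n)}"
proof (induction n)
  case 0
  then show ?case by (simp add: off_1)
next
  case (Suc n)
  have "(\<Union>i\<in>{1..Suc n}. {off i..<off (Suc i)}) = {..<off (Suc n)} \<union> {off (Suc n)..<off (Suc (Suc n))}"
    using Suc by (simp add: atLeastAtMostSuc_conv Un_commute)
  also have "\<dots> = {..<off (Suc (Suc n))}"
    using off_mono[of "Suc n" "Suc (Suc n)"] by auto
  finally show ?case .
qed

lemma off_bound:
  assumes "i \<in> {1..F}" "t < w (block_of i)"
  shows "off i + t < L"
proof -
  have "off (Suc i) \<le> off (Suc F)" using assms by (intro off_mono) auto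
  then show ?thesis using assms by (simp add: off_Suc off_last)
qed

text \<open>The packets cover the whole file, so decoding may proceed coordinate by
  coordinate.\<close>

lemma coordinate_cases:
  assumes "l < L"
  obtains b s t where "b < B" "0 < s" "s < M" "t < w b" "l = off (idx b s) + t"
proof -
  obtain i where i: "i \<in> {1..F}" "off i \<le> l" "l < off (Suc i)"
  proof -
    have "l \<in> (\<Union>i\<in>{1..F}. {off i..<off (Suc i)})"
      using assms unfolding off_cover off_last by simp
    then show thesis using that by auto
  qed
  show thesis
    by (rule that[of "block_of i" "sub_of i" "l - off i"]) (use i block_of_less[OF i(1)] sub_of_pos sub_of_less idx_block_of_sub_of[OF i(1)] in \<open>auto simp: off_Suc\<close>)
qed

lemma L_pos: "1 \<le> L"
  using N M by (simp add: L_def)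

section \<open>Query matrices modulo \<open>M\<close> and their row sums\<close>

text \<open>
  Randomness and queries are \<open>B \<times> K\<close> matrices over \<open>{..<M}\<close>, stored row by row; the columns are
  numbered from 1, like the files.
\<close>

definition ent_of :: "nat list \<Rightarrow> nat \<Rightarrow> nat \<Rightarrow> nat" where
  "ent_of x b k = x ! (b * K + (k - 1))"

definition mat_of :: "(nat \<Rightarrow> nat \<Rightarrow> nat) \<Rightarrow> nat list" where
  "mat_of g = map (\<lambda>j. g (j div K) (Suc (j mod K))) [0..<B * K]"

definition matrices :: "nat list set" where
  "matrices = {x. length x = B * K \<and> set x \<subseteq> {..<M}}"

text \<open>Row sums 0 give the keys drawn by the user, row sums \<open>shift_of n\<close> the
  possible queries to server \<open>n\<close>; neither set refers to the desired file.\<close>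

definition with_sums :: "(nat \<Rightarrow> nat) \<Rightarrow> nat list set" where
  "with_sums c = {x \<in> matrices. \<forall>b<B. (\<Sum>k=1..K. ent_of x b k) mod M = c b mod M}"

definition add_col :: "nat \<Rightarrow> (nat \<Rightarrow> nat) \<Rightarrow> nat list \<Rightarrow> nat list" where
  "add_col \<theta> c x = mat_of (\<lambda>b k. (ent_of x b k + (if k = \<theta> then c b else 0)) mod M)"

lemma position_bound: "b < B \<Longrightarrow> k \<in> {1..K} \<Longrightarrow> b * K + (k - 1) < B * K"
proof -
  assume "b < B" "k \<in> {1..K}"
  then have "b * K + (k - 1) < Suc b * K" by auto
  also have "\<dots> \<le> B * K" using \<open>b < B\<close> by (intro mult_le_mono1) simp
  finally show ?thesis .
qed

lemma ent_of_mat_of: "b < B \<Longrightarrow> k \<in> {1..K} \<Longrightarrow> ent_of (mat_of g) b k = g b k"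
  using position_bound[of b k] by (cases k) (auto simp: ent_of_def mat_of_def)

lemma mat_of_ent_of:
  assumes "x \<in> matrices" "\<And>b k. b < B \<Longrightarrow> k \<in> {1..K} \<Longrightarrow> g b k = ent_of x b k"
  shows "mat_of g = x"
proof (rule nth_equalityI)
  show "length (mat_of g) = length x"
    using assms by (simp add: mat_of_def matrices_def)
  fix j assume "j < length (mat_of g)"
  then have j: "j < B * K" by (simp add: mat_of_def)
  then have "j div K < B" by (simp add: less_mult_imp_div_less)
  moreover have "Suc (j mod K) \<in> {1..K}" using K by (simp add: Suc_le_eq)
  ultimately have "g (j div K) (Suc (j mod K)) = x ! j"
    using assms(2) by (simp add: ent_of_def)
  then show "mat_of g ! j = x ! j" using j by (simp add: mat_of_def)
qed

lemma mat_of_in_matrices: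
  assumes "\<And>b k. b < B \<Longrightarrow> k \<in> {1..K} \<Longrightarrow> g b k < M"
  shows "mat_of g \<in> matrices"
proof -
  have "g (j div K) (Suc (j mod K)) < M" if "j < B * K" for j
    using that K by (intro assms) (auto simp: less_mult_imp_div_less Suc_le_eq)
  then show ?thesis by (auto simp: matrices_def mat_of_def)
qed

lemma ent_of_less: "x \<in> matrices \<Longrightarrow> b < B \<Longrightarrow> k \<in> {1..K} \<Longrightarrow> ent_of x b k < M"
  using position_bound[of b k] by (auto simp: matrices_def ent_of_def subset_iff)

lemma with_sums_matrices: "x \<in> with_sums c \<Longrightarrow> x \<in> matrices"
  unfolding with_sums_def by blast

lemma finite_with_sums: "finite (with_sums c)"
proof (rule finite_subset)
  show "with_sums c \<subseteq> {x. set x \<subseteq> {..<M} \<and> length x = B * K}"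
    by (auto simp: with_sums_def matrices_def)
qed (rule finite_lists_length_eq, simp)

lemma with_sums_nonempty: "with_sums (\<lambda>_. 0) \<noteq> {}"
proof -
  have "mat_of (\<lambda>_ _. 0) \<in> with_sums (\<lambda>_. 0)"
    using M by (auto simp: with_sums_def ent_of_mat_of intro!: mat_of_in_matrices)
  then show ?thesis by blast
qed

lemma ent_of_add_col:
  "b < B \<Longrightarrow> k \<in> {1..K} \<Longrightarrow> ent_of (add_col \<theta> c x) b k = (ent_of x b k + (if k = \<theta> then c b else 0)) mod M"
  unfolding add_col_def by (rule ent_of_mat_of)

lemma add_col_in_with_sums:
  assumes "x \<in> with_sums c" "\<theta> \<in> {1..K}" "\<And>b. b < B \<Longrightarrow> (c b + c' b) mod M = c'' b mod M"
  shows "add_col \<theta> c' x \<in> with_sums c''"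
  unfolding with_sums_def
proof (intro CollectI conjI allI impI)
  show "add_col \<theta> c' x \<in> matrices"
    using M by (auto simp: add_col_def intro!: mat_of_in_matrices)
  fix b assume b: "b < B"
  have "(\<Sum>k=1..K. ent_of (add_col \<theta> c' x) b k) mod M =
      (\<Sum>k=1..K. (ent_of x b k + (if k = \<theta> then c' b else 0)) mod M) mod M"
    using b by (intro arg_cong[where f = "\<lambda>s. s mod M"] sum.cong) (simp_all add: ent_of_add_col)
  also have "\<dots> = (\<Sum>k=1..K. ent_of x b k + (if k = \<theta> then c' b else 0)) mod M"
    by (rule mod_sum_eq)
  also have "\<dots> = ((\<Sum>k=1..K. ent_of x b k) + c' b) mod M"
    using assms(2) by (simp add: sum.distrib)
  also have "\<dots> = (c b + c' b) mod M"
    using assms(1) b by (intro mod_add_cong) (simp_all add: with_sums_def)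
  finally show "(\<Sum>k=1..K. ent_of (add_col \<theta> c' x) b k) mod M = c'' b mod M"
    using assms(3)[OF b] by simp
qed

lemma add_col_inverse:
  assumes "x \<in> matrices" "\<And>b. b < B \<Longrightarrow> (c b + c' b) mod M = 0"
  shows "add_col \<theta> c' (add_col \<theta> c x) = x"
  unfolding add_col_def[of _ c']
proof (rule mat_of_ent_of[OF assms(1)])
  fix b k assume bk: "b < B" "k \<in> {1..K}"
  have "(ent_of x b k + c b + c' b) mod M = (ent_of x b k + (c b + c' b) mod M) mod M"
    by (simp add: mod_add_right_eq add.assoc)
  also have "\<dots> = ent_of x b k"
    using assms(2) bk ent_of_less[OF assms(1) bk] by simp
  finally show "(ent_of (add_col \<theta> c x) b k + (if k = \<theta> then c' b else 0)) mod M = ent_of x b k"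
    using bk ent_of_less[OF assms(1) bk] by (auto simp: ent_of_add_col mod_add_left_eq)
qed

text \<open>Adding \<open>M - c b\<close> undoes the shift modulo \<open>M\<close>. Hence a uniform
  key turns into a uniform matrix with row sums \<open>c\<close>, whichever column was
  shifted.\<close>

lemma bij_betw_add_col:
  assumes "\<theta> \<in> {1..K}" "\<And>b. c b \<le> M"
  shows "bij_betw (add_col \<theta> c) (with_sums (\<lambda>_. 0)) (with_sums c)"
proof (rule bij_betw_byWitness[where f' = "add_col \<theta> (\<lambda>b. M - c b)"])
  have c: "(c b + (M - c b)) mod M = 0" "((M - c b) + c b) mod M = 0" for b
    using assms(2)[of b] by simp_all
  show "\<forall>x\<in>with_sums (\<lambda>_. 0). add_col \<theta> (\<lambda>b. M - c b) (add_col \<theta> c x) = x"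
    using c by (auto simp: with_sums_def intro!: add_col_inverse)
  show "\<forall>x\<in>with_sums c. add_col \<theta> c (add_col \<theta> (\<lambda>b. M - c b) x) = x"
    using c by (auto simp: with_sums_def intro!: add_col_inverse)
  show "add_col \<theta> c ` with_sums (\<lambda>_. 0) \<subseteq> with_sums c"
    using assms(1) by (auto intro: add_col_in_with_sums)
  show "add_col \<theta> (\<lambda>b. M - c b) ` with_sums c \<subseteq> with_sums (\<lambda>_. 0)"
    using assms(1) c by (auto intro: add_col_in_with_sums)
qed

text \<open>A zero row can be overwritten by a row of sum 0 in \<open>M ^ (K - 1)\<close> ways,
  since all entries but the first are free and the first is then forced. Every key arises in this
  way exactly once.\<close>

lemma card_zero_row:
  assumes b: "b < B"
  shows "card {x \<in> with_sums (\<lambda>_. 0). \<forall>k\<in>{1..K}. ent_of x b k = 0} * M ^ (K - 1) =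
         card (with_sums (\<lambda>_. 0))"
proof -
  let ?Z = "{x \<in> with_sums (\<lambda>_. 0). \<forall>k\<in>{1..K}. ent_of x b k = 0}"
  let ?V = "{2..K} \<rightarrow>\<^sub>E {..<M}"
  \<comment> \<open>The entry of column 1 that completes the row to sum 0; the outer
    \<open>mod\<close> turns the value \<open>M\<close>, which occurs when the other entries already
    sum to 0, into 0.\<close>
  define neg where "neg v = (M - (\<Sum>k=2..K. v k) mod M) mod M" for v :: "nat \<Rightarrow> nat"
  \<comment> \<open>\<open>ins\<close> overwrites row \<open>b\<close>; its inverse
    \<open>del\<close> clears this row and records the columns from 2 on, made extensional by
    \<open>restrict\<close>.\<close>
  define ins where "ins = (\<lambda>(x, v). mat_of (\<lambda>b' k. if b' = b then (if k = 1 then neg v else v k) else ent_of x b' k))"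
  define del where "del x = (mat_of (\<lambda>b' k. if b' = b then 0 else ent_of x b' k), restrict (ent_of x b) {2..K})" for x
  have split: "(\<Sum>k=1..K. g k) = g 1 + (\<Sum>k=2..K. g k)" for g :: "nat \<Rightarrow> nat"
    using K by (simp add: sum.atLeast_Suc_atMost numeral_2_eq_2)
  have neg: "(neg v + (\<Sum>k=2..K. v k)) mod M = 0" for v
  proof -
    have "(neg v + (\<Sum>k=2..K. v k)) mod M = ((M - (\<Sum>k=2..K. v k) mod M) + (\<Sum>k=2..K. v k) mod M) mod M"
      unfolding neg_def by (simp add: mod_simps)
    also have "\<dots> = 0"
      using M by (simp add: less_imp_le)
    finally show ?thesis .
  qed
  \<comment> \<open>Needed for \<open>ins (del x) = x\<close>: the entry of column 1 is recovered
    from the others, since two residues below \<open>M\<close> sum to 0 modulo \<open>M\<close> only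
    as 0 or \<open>M\<close>.\<close>
  have neg_unique: "a = neg v" if "(a + (\<Sum>k=2..K. v k)) mod M = 0" "a < M" for a v
  proof -
    define s where "s = (\<Sum>k=2..K. v k) mod M"
    have "s < M" using M by (simp add: s_def)
    have "(a + s) mod M = 0"
      using that(1) by (simp add: s_def mod_simps)
    then have "a + s = 0 \<or> a + s = M"
      using \<open>a < M\<close> \<open>s < M\<close> by (auto simp: mod_if split: if_splits)
    then show ?thesis
      using \<open>a < M\<close> \<open>s < M\<close> by (auto simp: neg_def simp flip: s_def)
  qed
  have "bij_betw ins (?Z \<times> ?V) (with_sums (\<lambda>_. 0))"
  proof (rule bij_betw_byWitness[where f' = del])
    have ins_mem: "ins (x, v) \<in> with_sums (\<lambda>_. 0)" if x: "x \<in> ?Z" and v: "v \<in> ?V" for x v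
      unfolding with_sums_def
    proof (intro CollectI conjI allI impI)
      show "ins (x, v) \<in> matrices"
        unfolding ins_def prod.case
      proof (rule mat_of_in_matrices)
        fix b' k assume bk: "b' < B" "k \<in> {1..K}"
        have "neg v < M" using M by (simp add: neg_def)
        moreover have "v k < M" if "k \<noteq> 1" using that bk v by (auto simp: PiE_iff)
        moreover have "ent_of x b' k < M"
          using x bk with_sums_matrices by (intro ent_of_less) blast+
        ultimately show "(if b' = b then if k = 1 then neg v else v k else ent_of x b' k) < M" by simp
      qed
      fix b' assume b': "b' < B"
      have "(\<Sum>k=1..K. ent_of (ins (x, v)) b' k) =
          (\<Sum>k=1..K. if b' = b then (if k = 1 then neg v else v k) else ent_of x b' k)"
        using b' by (intro sum.cong) (simp_all add: ins_def ent_of_mat_of)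
      also have "\<dots> mod M = 0"
      proof (cases "b' = b")
        case True
        then show ?thesis using neg[of v] unfolding split by simp
      next
        case False
        then show ?thesis using x b' by (simp add: with_sums_def)
      qed
      finally show "(\<Sum>k=1..K. ent_of (ins (x, v)) b' k) mod M = 0 mod M" by simp
    qed
    then show "ins ` (?Z \<times> ?V) \<subseteq> with_sums (\<lambda>_. 0)" by blast
    show "\<forall>p\<in>?Z \<times> ?V. del (ins p) = p"
    proof
      fix p assume "p \<in> ?Z \<times> ?V"
      then obtain x v where p: "p = (x, v)" "x \<in> ?Z" "v \<in> ?V" by auto
      have "mat_of (\<lambda>b' k. if b' = b then 0 else ent_of (ins (x, v)) b' k) = x"
        using p by (intro mat_of_ent_of) (auto simp: ins_def ent_of_mat_of intro: with_sums_matrices)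
      moreover have "restrict (ent_of (ins (x, v)) b) {2..K} = v"
        using p b by (intro ext) (auto simp: restrict_def ins_def ent_of_mat_of PiE_iff extensional_def)
      ultimately show "del (ins p) = p"
        using p by (simp add: del_def)
    qed
    show "\<forall>x\<in>with_sums (\<lambda>_. 0). ins (del x) = x"
    proof
      fix x assume x: "x \<in> with_sums (\<lambda>_. 0)"
      then have x': "x \<in> matrices" by (rule with_sums_matrices)
      show "ins (del x) = x"
        unfolding del_def ins_def prod.case
      proof (rule mat_of_ent_of[OF x'])
        fix b' k assume bk: "b' < B" "k \<in> {1..K}"
        have "(ent_of x b 1 + (\<Sum>k=2..K. restrict (ent_of x b) {2..K} k)) mod M = 0"
        proof -
          have "(\<Sum>k=1..K. ent_of x b k) mod M = 0"
            using x b by (simp add: with_sums_def)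
          then show ?thesis
            unfolding split by simp
        qed
        moreover have "ent_of x b 1 < M"
          using x' b K by (intro ent_of_less) auto
        ultimately have "ent_of x b 1 = neg (restrict (ent_of x b) {2..K})"
          by (rule neg_unique)
        then show "(if b' = b then if k = 1 then neg (restrict (ent_of x b) {2..K})
              else restrict (ent_of x b) {2..K} k
            else ent_of (mat_of (\<lambda>b' k. if b' = b then 0 else ent_of x b' k)) b' k) = ent_of x b' k"
          using bk by (auto simp: ent_of_mat_of)
      qed
    qed
    show "del ` with_sums (\<lambda>_. 0) \<subseteq> ?Z \<times> ?V"
    proof (rule image_subsetI)
      fix x assume x: "x \<in> with_sums (\<lambda>_. 0)"
      let ?x = "mat_of (\<lambda>b' k. if b' = b then 0 else ent_of x b' k)"
      have mat: "x \<in> matrices" using x by (rule with_sums_matrices)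
      have "?x \<in> matrices"
      proof (rule mat_of_in_matrices)
        fix b' k assume "b' < B" "k \<in> {1..K}"
        from ent_of_less[OF mat this] show "(if b' = b then 0 else ent_of x b' k) < M" by simp
      qed
      moreover have "(\<Sum>k=1..K. ent_of ?x b' k) mod M = 0" if "b' < B" for b'
      proof -
        have "(\<Sum>k=1..K. ent_of ?x b' k) = (\<Sum>k=1..K. if b' = b then 0 else ent_of x b' k)"
          using that by (intro sum.cong) (simp_all add: ent_of_mat_of)
        then show ?thesis using x that by (cases "b' = b") (simp_all add: with_sums_def)
      qed
      ultimately have "?x \<in> ?Z"
        using b by (simp add: with_sums_def ent_of_mat_of)
      moreover have "restrict (ent_of x b) {2..K} \<in> ?V"
        using x b by (auto simp: with_sums_def intro!: ent_of_less)
      ultimately show "del x \<in> ?Z \<times> ?V"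
        by (simp add: del_def)
    qed
  qed
  then have "card (?Z \<times> ?V) = card (with_sums (\<lambda>_. 0))"
    by (rule bij_betw_same_card)
  then show ?thesis
    by (simp add: card_cartesian_product card_PiE)
qed

section \<open>Answers and decoding\<close>

text \<open>The value 0 serves two purposes: \<open>s = 0\<close> selects no packet, and positions
  \<open>t\<close> past the end of the packet are zero-padding.\<close>

definition part :: "(nat \<Rightarrow> 'f list) \<Rightarrow> nat \<Rightarrow> nat \<Rightarrow> nat \<Rightarrow> nat \<Rightarrow> 'f::field" where
  "part f b k s t = (if 0 < s \<and> t < w b then f k ! (off (idx b s) + t) else 0)"

definition comb :: "(nat \<Rightarrow> 'f list) \<Rightarrow> nat list \<Rightarrow> nat \<Rightarrow> nat \<Rightarrow> 'f::field" where
  "comb f x b t = (\<Sum>k=1..K. part f b k (ent_of x b k) t)"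

definition stored_at :: "nat \<Rightarrow> nat set" where
  "stored_at n = {i \<in> {1..F}. n \<in> blk (block_of i)}"

text \<open>The length that \<open>lin_comb\<close> prescribes at server \<open>n\<close>, expressed
  by the dimensions \<open>w\<close>.\<close>

definition width :: "nat \<Rightarrow> nat" where
  "width n = Max (insert 0 ((\<lambda>(k, i). w (block_of i)) ` ({1..K} \<times> stored_at n)))"

text \<open>Every server returns \<open>B\<close> combinations; those for blocks it does not belong
  to are zero vectors, and so are those for zero rows. They are constant given the query, hence cost
  nothing in a download measured by entropy.\<close>

definition resp :: "nat \<Rightarrow> (nat \<Rightarrow> 'f list) \<Rightarrow> nat list \<Rightarrow> 'f::field list list" where
  "resp n f x = map (\<lambda>b. map (\<lambda>t. if n \<in> blk b then comb f x b t else 0) [0..<width n]) [0..<B]"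

definition files :: "(nat \<Rightarrow> 'f list) set" where
  "files = {1..K} \<rightarrow>\<^sub>E vectors L"

text \<open>For blocks not containing it a server sees the unshifted key row. The guard
  \<open>b < B\<close> bounds the shift for all \<open>b\<close>, as \<open>bij_betw_add_col\<close>
  requires.\<close>

definition shift_of :: "nat \<Rightarrow> nat \<Rightarrow> nat" where
  "shift_of n b = (if b < B \<and> n \<in> blk b then pos b n else 0)"

definition qry :: "nat \<Rightarrow> nat \<Rightarrow> nat list \<Rightarrow> nat list" where
  "qry \<theta> n = add_col \<theta> (shift_of n)"

abbreviation keys :: "nat list set" where
  "keys \<equiv> with_sums (\<lambda>_. 0)"

lemma shift_of_less: "shift_of n b < M"
proof (cases "b < B \<and> n \<in> blk b")
  case True
  then have "pos b n \<in> {..<M}" using pos[of b] by (auto simp: bij_betw_def)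
  then show ?thesis using True by (simp add: shift_of_def)
next
  case False
  then have "shift_of n b = 0" unfolding shift_of_def by (rule if_not_P)
  then show ?thesis using M by simp
qed

lemma bij_betw_qry: "\<theta> \<in> {1..K} \<Longrightarrow> bij_betw (qry \<theta> n) keys (with_sums (shift_of n))"
  unfolding qry_def by (rule bij_betw_add_col) (simp_all add: shift_of_less less_imp_le)

lemma qry_in: "\<theta> \<in> {1..K} \<Longrightarrow> \<rho> \<in> keys \<Longrightarrow> qry \<theta> n \<rho> \<in> matrices"
  using bij_betwE[OF bij_betw_qry, of \<theta> n] with_sums_matrices by blast

lemma finite_stored_at: "finite (stored_at n)"
  by (simp add: stored_at_def)

lemma width_ge:
  assumes "b < B" "n \<in> blk b"
  shows "w b \<le> width n"
proof -
  \<comment> \<open>Packet 1 of the block exists because \<open>M\<close> is at least 2, and it has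
    dimension \<open>w b\<close>.\<close>
  have "idx b 1 \<in> stored_at n" "block_of (idx b 1) = b"
    using idx_mem[of b 1] block_of_idx[of 1 b] assms M by (simp_all add: stored_at_def)
  then have "w b \<in> (\<lambda>(k, i). w (block_of i)) ` ({1..K} \<times> stored_at n)"
    using K by (intro image_eqI[of _ _ "(1, idx b 1)"]) auto
  then show ?thesis
    unfolding width_def by (intro Max_ge) (auto simp: finite_stored_at)
qed

lemma comb_outside: "w b \<le> t \<Longrightarrow> comb f x b t = 0"
  by (simp add: comb_def part_def)

text \<open>Beyond \<open>w b\<close> the combination of row \<open>b\<close> vanishes, and
  \<open>w b\<close> never exceeds the length \<open>width n\<close>, so padding does not affect
  equality.\<close>

lemma resp_eq_iff:
  "resp n f x = resp n f' x \<longleftrightarrow> (\<forall>b<B. n \<in> blk b \<longrightarrow> (\<forall>t<w b. comb f x b t = comb f' x b t))"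
proof -
  have "resp n f x = resp n f' x \<longleftrightarrow>
      (\<forall>b<B. \<forall>t<width n. n \<in> blk b \<longrightarrow> comb f x b t = comb f' x b t)"
    by (auto simp: resp_def)
  also have "\<dots> \<longleftrightarrow> (\<forall>b<B. n \<in> blk b \<longrightarrow> (\<forall>t<w b. comb f x b t = comb f' x b t))"
  proof (intro iffI allI impI)
    fix b t assume "\<forall>b<B. \<forall>t<width n. n \<in> blk b \<longrightarrow> comb f x b t = comb f' x b t"
      and "b < B" "n \<in> blk b" "t < w b"
    moreover from this have "t < width n" using width_ge[of b n] by simp
    ultimately show "comb f x b t = comb f' x b t" by blast
  next
    fix b t assume "\<forall>b<B. n \<in> blk b \<longrightarrow> (\<forall>t<w b. comb f x b t = comb f' x b t)"
      and "b < B" "n \<in> blk b"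
    then show "comb f x b t = comb f' x b t"
      by (cases "t < w b") (simp_all add: comb_outside)
  qed
  finally show ?thesis .
qed

lemma finite_files: "finite (files :: (nat \<Rightarrow> 'f::finite list) set)"
proof -
  have "finite (vectors L :: 'f list set)"
    using finite_lists_length_eq[of "UNIV :: 'f set" L] by (simp add: vectors_def)
  then show ?thesis by (simp add: files_def finite_PiE)
qed

lemma files_nonempty: "files \<noteq> {}"
proof -
  have "replicate L undefined \<in> vectors L" by (simp add: vectors_def)
  then show ?thesis by (auto simp: files_def PiE_eq_empty_iff)
qed

text \<open>
  Two servers of a block whose queries differ only in the desired column, one of them asking for
  nothing in this column, return sums that differ by the desired packet.
\<close>

lemma decode:
  assumes \<rho>: "\<rho> \<in> keys" and \<theta>: "\<theta> \<in> {1..K}" and b: "b < B" and s: "0 < s" "s < M" and t: "t < w b"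
  obtains n n' where "n \<in> blk b" "n' \<in> blk b"
    "\<And>f :: nat \<Rightarrow> 'f::field list. comb f (qry \<theta> n \<rho>) b t - comb f (qry \<theta> n' \<rho>) b t = f \<theta> ! (off (idx b s) + t)"
proof -
  have mat: "\<rho> \<in> matrices" using \<rho> by (rule with_sums_matrices)
  \<comment> \<open>The positions of the servers of a block run through all residues, so every value
    \<open>u\<close> is asked for in the desired column by some server.\<close>
  have server: "\<exists>n\<in>blk b. ent_of (qry \<theta> n \<rho>) b \<theta> = u \<and>
      (\<forall>k\<in>{1..K} - {\<theta>}. ent_of (qry \<theta> n \<rho>) b k = ent_of \<rho> b k)" if "u < M" for u
  proof -
    let ?e = "ent_of \<rho> b \<theta>"
    have e: "?e < M" using mat b \<theta> by (rule ent_of_less)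
    \<comment> \<open>The position sought is \<open>u - ?e\<close> modulo \<open>M\<close>, with
      \<open>M - ?e\<close> in place of a negative number.\<close>
    have "(u + (M - ?e)) mod M \<in> pos b ` blk b"
      using pos[OF b] M by (simp add: bij_betw_def)
    then obtain n where n: "n \<in> blk b" "pos b n = (u + (M - ?e)) mod M" by auto
    have "ent_of (qry \<theta> n \<rho>) b \<theta> = (?e + (u + (M - ?e)) mod M) mod M"
      using b \<theta> n by (simp add: qry_def ent_of_add_col shift_of_def)
    also have "\<dots> = (?e + (u + (M - ?e))) mod M"
      by (simp add: mod_add_right_eq)
    also have "?e + (u + (M - ?e)) = u + M"
      using e by simp
    finally have "ent_of (qry \<theta> n \<rho>) b \<theta> = u"
      using that by simp
    moreover have "ent_of (qry \<theta> n \<rho>) b k = ent_of \<rho> b k" if "k \<in> {1..K} - {\<theta>}" for k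
      using that b ent_of_less[OF mat b, of k] by (simp add: qry_def ent_of_add_col)
    ultimately show ?thesis using n by blast
  qed
  obtain n where n: "n \<in> blk b" "ent_of (qry \<theta> n \<rho>) b \<theta> = s"
    "\<forall>k\<in>{1..K} - {\<theta>}. ent_of (qry \<theta> n \<rho>) b k = ent_of \<rho> b k"
    using server[OF s(2)] by blast
  obtain n' where n': "n' \<in> blk b" "ent_of (qry \<theta> n' \<rho>) b \<theta> = 0"
    "\<forall>k\<in>{1..K} - {\<theta>}. ent_of (qry \<theta> n' \<rho>) b k = ent_of \<rho> b k"
    using server[of 0] M by auto
  show thesis
  proof (rule that[OF n(1) n'(1)])
    fix f :: "nat \<Rightarrow> 'f list"
    have split: "comb f x b t = part f b \<theta> (ent_of x b \<theta>) t +
        (\<Sum>k\<in>{1..K} - {\<theta>}. part f b k (ent_of x b k) t)" for x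
      unfolding comb_def using \<theta> by (intro sum.remove) auto
    show "comb f (qry \<theta> n \<rho>) b t - comb f (qry \<theta> n' \<rho>) b t = f \<theta> ! (off (idx b s) + t)"
      unfolding split using n n' s t by (simp add: part_def)
  qed
qed

section \<open>The expected download\<close>

text \<open>By \<open>card_resp_fibre\<close> these are the rows whose answers carry information,
  \<open>w b\<close> symbols each.\<close>

definition active :: "nat \<Rightarrow> nat list \<Rightarrow> nat set" where
  "active n x = {b. b < B \<and> n \<in> blk b \<and> (\<exists>k\<in>{1..K}. ent_of x b k \<noteq> 0)}"

text \<open>
  Every nonzero row of a query contains a packet that occurs in no other row, so that the answer
  can be changed at will by changing these packets only.
\<close>

lemma card_resp_fibre:
  fixes f :: "nat \<Rightarrow> 'f::{finite,field} list"
  assumes x: "x \<in> matrices" and f: "f \<in> files"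
  shows "card {g \<in> files. resp n g x = resp n f x} * CARD('f) ^ (\<Sum>b\<in>active n x. w b) =
         card (files :: (nat \<Rightarrow> 'f list) set)"
proof -
  let ?A = "active n x"
  let ?files = "files :: (nat \<Rightarrow> 'f list) set"
  have finA: "finite ?A" by (simp add: active_def)
  have "\<forall>b\<in>?A. \<exists>k. k \<in> {1..K} \<and> ent_of x b k \<noteq> 0"
    by (auto simp: active_def)
  \<comment> \<open>In each active row one column with a nonzero entry is fixed; the packet selected
    there will absorb all changes of the answer to this row.\<close>
  then obtain kk where kk: "\<And>b. b \<in> ?A \<Longrightarrow> kk b \<in> {1..K} \<and> ent_of x b (kk b) \<noteq> 0"
    by metis
  \<comment> \<open>One index for every symbol of the answers to active rows; \<open>loc\<close> is
    a coordinate of file \<open>kk b\<close> that enters this symbol.\<close>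
  define I where "I = (SIGMA b:?A. {..<w b})"
  define loc where "loc = (\<lambda>(b, t). off (idx b (ent_of x b (kk b))) + t)"
  \<comment> \<open>\<open>add a g\<close> changes the files by \<open>a p\<close> at these places.
    Distinct indices have distinct places, so at most one term of the sum is nonzero.\<close>
  define delta where "delta a k l = (\<Sum>p\<in>I. if k = kk (fst p) \<and> l = loc p then a p else 0)"
    for a :: "nat \<times> nat \<Rightarrow> 'f" and k l
  define add where "add a g = restrict (\<lambda>k. map (\<lambda>l. g k ! l + delta a k l) [0..<L]) {1..K}"
    for a and g :: "nat \<Rightarrow> 'f list"
  define cb where "cb g p = comb g x (fst p) (snd p)" for g :: "nat \<Rightarrow> 'f list" and p
  have finI: "finite I" using finA by (simp add: I_def)
  have lt: "ent_of x b k < M" if "b < B" "k \<in> {1..K}" for b k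
    using x that by (rule ent_of_less)
  have add_mem: "add a g \<in> ?files" for a g
    by (auto simp: add_def files_def vectors_def)
  \<comment> \<open>The change reaches only the chosen term of each active row: equal coordinates
    force equal packets by \<open>off_inj\<close>, hence equal blocks and equal
    \<open>t\<close>.\<close>
  have add_part: "part (add a g) b k (ent_of x b k) t =
      part g b k (ent_of x b k) t + (if (b, t) \<in> I \<and> k = kk b then a (b, t) else 0)"
    if bk: "b < B" "k \<in> {1..K}" for a g b k t
  proof (cases "0 < ent_of x b k \<and> t < w b")
    case False
    moreover from this have "\<not> ((b, t) \<in> I \<and> k = kk b)"
      using kk[of b] by (auto simp: I_def)
    moreover have "part h b k (ent_of x b k) t = 0" for h :: "nat \<Rightarrow> 'f list"
      using False by (auto simp: part_def)
    ultimately show ?thesis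
      by (simp only: simp_thms if_False add_0_right)
  next
    case True
    let ?l = "off (idx b (ent_of x b k)) + t"
    note pos_lt = conjunct1[OF True] lt[OF bk]
    note i = idx_mem[OF bk(1) pos_lt] block_of_idx[OF pos_lt]
    have "?l < L"
      using off_bound[OF i(1)] i(2) True by simp
    then have "part (add a g) b k (ent_of x b k) t = part g b k (ent_of x b k) t + delta a k ?l"
      using True bk by (simp add: part_def add_def)
    moreover have "delta a k ?l = (\<Sum>p\<in>I. if p = (b, t) then (if k = kk b then a (b, t) else 0) else 0)"
      unfolding delta_def
    proof (rule sum.cong[OF refl])
      fix p assume p: "p \<in> I"
      obtain b' t' where p_eq: "p = (b', t')" by (cases p)
      have b': "b' \<in> ?A" "t' < w b'" "b' < B" using p p_eq by (auto simp: I_def active_def)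
      have "p = (b, t)" if "k = kk (fst p)" "?l = loc p"
      proof -
        have k: "0 < ent_of x b' k" using kk[OF b'(1)] that p_eq by simp
        note k_lt = k lt[OF b'(3) bk(2)]
        note i' = idx_mem[OF b'(3) k_lt] block_of_idx[OF k_lt]
        have eq: "off (idx b (ent_of x b k)) + t = off (idx b' (ent_of x b' k)) + t'"
          using that p_eq by (simp add: loc_def)
        have bounds: "1 \<le> idx b (ent_of x b k)" "1 \<le> idx b' (ent_of x b' k)"
          using i(1) i'(1) by simp_all
        have sizes: "t < w (block_of (idx b (ent_of x b k)))" "t' < w (block_of (idx b' (ent_of x b' k)))"
          using True b'(2) by (simp_all only: i(2) i'(2))
        have idx_eq: "idx b (ent_of x b k) = idx b' (ent_of x b' k)"
          using off_inj[OF bounds sizes eq] .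
        then have "block_of (idx b (ent_of x b k)) = block_of (idx b' (ent_of x b' k))"
          by (rule arg_cong)
        then have "b = b'"
          by (simp only: i(2) i'(2))
        moreover have "t = t'" using eq idx_eq by simp
        ultimately show ?thesis using p_eq by simp
      qed
      moreover have "?l = loc p" if "p = (b, t)" "k = kk b"
        using that by (simp add: loc_def)
      ultimately have "k = kk (fst p) \<and> ?l = loc p \<longleftrightarrow> p = (b, t) \<and> k = kk b"
        by (metis fst_conv)
      then show "(if k = kk (fst p) \<and> ?l = loc p then a p else 0) =
          (if p = (b, t) then if k = kk b then a (b, t) else 0 else 0)"
        by simp
    qed
    ultimately show ?thesis
      using finI by simp
  qed
  have add_comb: "cb (add a g) p = cb g p + a p" if "p \<in> I" for a g p
  proof -
    obtain b t where p: "p = (b, t)" by (cases p)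
    then have b: "b \<in> ?A" "b < B" using that by (auto simp: I_def active_def)
    have "cb (add a g) p = (\<Sum>k=1..K. part g b k (ent_of x b k) t + (if (b, t) \<in> I \<and> k = kk b then a (b, t) else 0))"
      unfolding cb_def comb_def p fst_conv snd_conv using b by (intro sum.cong refl add_part) auto
    also have "\<dots> = cb g p + a p"
      using kk[OF b(1)] that p by (simp add: cb_def comb_def sum.distrib)
    finally show ?thesis .
  qed
  have delta_neg: "delta a' k l = - delta a k l" if "\<And>p. p \<in> I \<Longrightarrow> a' p = - a p" for a a' k l
    unfolding delta_def sum_negf[symmetric] using that by (intro sum.cong) auto
  have add_neg: "add a' (add a g) = g" if "\<And>p. p \<in> I \<Longrightarrow> a' p = - a p" "g \<in> ?files" for a a' g
  proof
    fix k
    show "add a' (add a g) k = g k"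
    proof (cases "k \<in> {1..K}")
      case True
      then have "length (g k) = L"
        using PiE_mem[of g "{1..K}" "\<lambda>_. vectors L" k] that(2) by (simp add: files_def vectors_def)
      then show ?thesis
        using True by (intro nth_equalityI) (simp_all add: add_def delta_neg[OF that(1)])
    next
      case False
      then show ?thesis using that(2) by (auto simp: files_def add_def PiE_iff extensional_def)
    qed
  qed
  \<comment> \<open>In a block of server \<open>n\<close> that is not active the row is zero and the
    combination vanishes for all files, so only the symbols indexed by \<open>I\<close>
    matter.\<close>
  have fib: "resp n g x = resp n f x \<longleftrightarrow> (\<forall>p\<in>I. cb g p = cb f p)" for g
  proof -
    have zero: "comb h x b t = 0" if "b < B" "n \<in> blk b" "b \<notin> ?A" for h :: "nat \<Rightarrow> 'f list" and b t
      using that by (auto simp: comb_def part_def active_def intro!: sum.neutral)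
    have "(\<forall>b<B. n \<in> blk b \<longrightarrow> (\<forall>t<w b. comb g x b t = comb f x b t)) \<longleftrightarrow>
        (\<forall>b\<in>?A. \<forall>t<w b. comb g x b t = comb f x b t)"
    proof (intro iffI allI impI ballI)
      fix b t assume *: "\<forall>b\<in>?A. \<forall>t<w b. comb g x b t = comb f x b t"
        and b: "b < B" "n \<in> blk b" and t: "t < w b"
      show "comb g x b t = comb f x b t"
      proof (cases "b \<in> ?A")
        case True
        then show ?thesis using * t by blast
      next
        case False
        then show ?thesis using zero[OF b] by simp
      qed
    qed (simp add: active_def)
    then show ?thesis
      unfolding resp_eq_iff by (auto simp: I_def cb_def)
  qed
  let ?V = "I \<rightarrow>\<^sub>E (UNIV :: 'f set)"
  let ?Fib = "{g \<in> ?files. resp n g x = resp n f x}"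
  \<comment> \<open>Every tuple of files arises exactly once from a member of the fibre and a free
    correction \<open>a\<close>, which is read off from the deviation of the answer.\<close>
  have "bij_betw (\<lambda>(g, a). add a g) (?Fib \<times> ?V) ?files"
  proof (rule bij_betw_byWitness[where f' = "\<lambda>g. (add (\<lambda>p. cb f p - cb g p) g, restrict (\<lambda>p. cb g p - cb f p) I)"])
    show "\<forall>q\<in>?Fib \<times> ?V. (\<lambda>g. (add (\<lambda>p. cb f p - cb g p) g, restrict (\<lambda>p. cb g p - cb f p) I))
        (case q of (g, a) \<Rightarrow> add a g) = q"
    proof
      fix q assume "q \<in> ?Fib \<times> ?V"
      then obtain g a where q: "q = (g, a)" "g \<in> ?files" "\<forall>p\<in>I. cb g p = cb f p" "a \<in> ?V"
        by (auto simp: fib)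
      have "restrict (\<lambda>p. cb (add a g) p - cb f p) I = a"
        using q by (auto simp: restrict_def add_comb PiE_iff extensional_def)
      moreover have "add (\<lambda>p. cb f p - cb (add a g) p) (add a g) = g"
        using q by (intro add_neg) (auto simp: add_comb)
      ultimately show "(\<lambda>g. (add (\<lambda>p. cb f p - cb g p) g, restrict (\<lambda>p. cb g p - cb f p) I))
        (case q of (g, a) \<Rightarrow> add a g) = q"
        using q by simp
    qed
    show "\<forall>g\<in>?files. (case (add (\<lambda>p. cb f p - cb g p) g, restrict (\<lambda>p. cb g p - cb f p) I)
        of (g, a) \<Rightarrow> add a g) = g"
      by (auto intro!: add_neg)
    show "(\<lambda>(g, a). add a g) ` (?Fib \<times> ?V) \<subseteq> ?files"
      using add_mem by auto
    show "(\<lambda>g. (add (\<lambda>p. cb f p - cb g p) g, restrict (\<lambda>p. cb g p - cb f p) I)) ` ?files \<subseteq> ?Fib \<times> ?V"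
      using add_mem by (auto simp: fib add_comb)
  qed
  then have "card (?Fib \<times> ?V) = card ?files"
    by (rule bij_betw_same_card)
  moreover have "card ?V = CARD('f) ^ (\<Sum>b\<in>?A. w b)"
    using finI finA by (simp add: card_PiE I_def)
  ultimately show ?thesis
    by (simp add: card_cartesian_product)
qed

text \<open>A zero row has sum 0, but its sum is congruent to the shift, which is below
  \<open>M\<close>; so the shift is 0 and the query row is the key row.\<close>

lemma qry_row_eq_0_iff:
  assumes \<rho>: "\<rho> \<in> keys" and \<theta>: "\<theta> \<in> {1..K}" and b: "b < B"
  shows "(\<forall>k\<in>{1..K}. ent_of (qry \<theta> n \<rho>) b k = 0) \<longleftrightarrow>
    shift_of n b = 0 \<and> (\<forall>k\<in>{1..K}. ent_of \<rho> b k = 0)"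
proof
  assume 0: "\<forall>k\<in>{1..K}. ent_of (qry \<theta> n \<rho>) b k = 0"
  have "qry \<theta> n \<rho> \<in> with_sums (shift_of n)"
    using bij_betw_qry[OF \<theta>, of n] \<rho> by (auto simp: bij_betw_def)
  then have "(\<Sum>k=1..K. ent_of (qry \<theta> n \<rho>) b k) mod M = shift_of n b mod M"
    using b by (simp add: with_sums_def)
  then have "shift_of n b = 0"
    using 0 shift_of_less[of n b] by simp
  have "ent_of \<rho> b k = 0" if "k \<in> {1..K}" for k
  proof -
    have "ent_of \<rho> b k < M" using with_sums_matrices[OF \<rho>] b that by (rule ent_of_less)
    moreover have "(ent_of \<rho> b k + (if k = \<theta> then shift_of n b else 0)) mod M = 0"
      using bspec[OF 0 that] that b by (simp add: qry_def ent_of_add_col)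
    ultimately show ?thesis
      using \<open>shift_of n b = 0\<close> by (cases "k = \<theta>") simp_all
  qed
  with \<open>shift_of n b = 0\<close> show "shift_of n b = 0 \<and> (\<forall>k\<in>{1..K}. ent_of \<rho> b k = 0)" by blast
next
  assume "shift_of n b = 0 \<and> (\<forall>k\<in>{1..K}. ent_of \<rho> b k = 0)"
  then show "\<forall>k\<in>{1..K}. ent_of (qry \<theta> n \<rho>) b k = 0"
    using b by (simp add: qry_def ent_of_add_col)
qed

text \<open>In a block all \<open>M\<close> servers are active, except that the one at position 0 is
  idle when the key row is zero. By \<open>card_zero_row\<close> this concerns the fraction
  \<open>1 / M ^ (K - 1)\<close> of the keys, and the weights of the blocks sum to
  \<open>N\<close>.\<close>

lemma sum_active_weights:
  assumes \<theta>: "\<theta> \<in> {1..K}"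
  shows "real (\<Sum>n=1..N. \<Sum>\<rho>\<in>keys. \<Sum>b\<in>active n (qry \<theta> n \<rho>). w b) =
    real N * (real M - 1 / real M ^ (K - 1)) * real (card keys)"
proof -
  define Z where "Z b = {\<rho> \<in> keys. \<forall>k\<in>{1..K}. ent_of \<rho> b k = 0}" for b
  have row: "real (\<Sum>\<rho>\<in>keys. card {n \<in> {1..N}. b \<in> active n (qry \<theta> n \<rho>)}) =
      (real M - 1 / real M ^ (K - 1)) * real (card keys)" if b: "b < B" for b
  proof -
    have "card {n \<in> {1..N}. b \<in> active n (qry \<theta> n \<rho>)} = M - (if \<rho> \<in> Z b then 1 else 0)"
      if \<rho>: "\<rho> \<in> keys" for \<rho>
    proof -
      have cardM: "card (blk b) = M"
        using bij_betw_same_card[OF pos[OF b]] by simp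
      have eq: "{n \<in> {1..N}. b \<in> active n (qry \<theta> n \<rho>)} =
          blk b - {n \<in> blk b. pos b n = 0 \<and> \<rho> \<in> Z b}"
      proof (rule set_eqI)
        fix n
        have "b \<in> active n (qry \<theta> n \<rho>) \<longleftrightarrow>
            n \<in> blk b \<and> \<not> (\<forall>k\<in>{1..K}. ent_of (qry \<theta> n \<rho>) b k = 0)"
          using b by (auto simp: active_def)
        also have "\<dots> \<longleftrightarrow> n \<in> blk b \<and> \<not> (pos b n = 0 \<and> \<rho> \<in> Z b)"
          unfolding qry_row_eq_0_iff[OF \<rho> \<theta> b] using b \<rho> by (auto simp: Z_def shift_of_def)
        finally show "n \<in> {n \<in> {1..N}. b \<in> active n (qry \<theta> n \<rho>)} \<longleftrightarrow>
            n \<in> blk b - {n \<in> blk b. pos b n = 0 \<and> \<rho> \<in> Z b}"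
          using blk[OF b] by blast
      qed
      show ?thesis
      proof (cases "\<rho> \<in> Z b")
        case True
        have "0 \<in> pos b ` blk b" using pos[OF b] M by (simp add: bij_betw_def)
        then obtain n where n: "n \<in> blk b" "pos b n = 0" by auto
        then have "{n \<in> blk b. pos b n = 0} = {n}"
          using pos[OF b] by (auto simp: bij_betw_def inj_on_def)
        then show ?thesis
          using eq True n cardM by (simp add: card_Diff_singleton)
      next
        case False
        then show ?thesis using eq cardM by simp
      qed
    qed
    then have "real (\<Sum>\<rho>\<in>keys. card {n \<in> {1..N}. b \<in> active n (qry \<theta> n \<rho>)}) =
        (\<Sum>\<rho>\<in>keys. real M - (if \<rho> \<in> Z b then 1 else 0))"
      using M by (auto simp: of_nat_diff intro!: sum.cong)
    also have "\<dots> = real M * real (card keys) - real (card (Z b))"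
      using finite_with_sums by (simp add: sum_subtractf sum.If_cases Z_def Int_def)
    also have "real (card (Z b)) = real (card keys) / real M ^ (K - 1)"
    proof -
      have "real (card (Z b)) * real M ^ (K - 1) = real (card keys)"
        using arg_cong[OF card_zero_row[OF b], of real] by (simp add: Z_def)
      then show ?thesis using M by (simp add: eq_divide_eq)
    qed
    finally show ?thesis by (simp add: algebra_simps)
  qed
  have "(\<Sum>n=1..N. \<Sum>\<rho>\<in>keys. \<Sum>b\<in>active n (qry \<theta> n \<rho>). w b) =
      (\<Sum>n=1..N. \<Sum>\<rho>\<in>keys. \<Sum>b<B. if b \<in> active n (qry \<theta> n \<rho>) then w b else 0)"
  proof (rule sum.cong[OF refl], rule sum.cong[OF refl])
    fix n \<rho>
    have "active n (qry \<theta> n \<rho>) = {..<B} \<inter> {b. b \<in> active n (qry \<theta> n \<rho>)}"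
      by (auto simp: active_def)
    then show "(\<Sum>b\<in>active n (qry \<theta> n \<rho>). w b) = (\<Sum>b<B. if b \<in> active n (qry \<theta> n \<rho>) then w b else 0)"
      by (simp add: sum.If_cases)
  qed
  \<comment> \<open>The sums are exchanged in order to count, block by block and key by key, the
    active servers.\<close>
  also have "\<dots> = (\<Sum>b<B. \<Sum>\<rho>\<in>keys. \<Sum>n=1..N. if b \<in> active n (qry \<theta> n \<rho>) then w b else 0)"
  proof -
    have "(\<Sum>n=1..N. \<Sum>\<rho>\<in>keys. \<Sum>b<B. g n \<rho> b) = (\<Sum>b<B. \<Sum>\<rho>\<in>keys. \<Sum>n=1..N. g n \<rho> b)"
      for g :: "nat \<Rightarrow> nat list \<Rightarrow> nat \<Rightarrow> nat"
    proof -
      have "(\<Sum>n=1..N. \<Sum>\<rho>\<in>keys. \<Sum>b<B. g n \<rho> b) = (\<Sum>\<rho>\<in>keys. \<Sum>n=1..N. \<Sum>b<B. g n \<rho> b)"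
        by (rule sum.swap)
      also have "\<dots> = (\<Sum>\<rho>\<in>keys. \<Sum>b<B. \<Sum>n=1..N. g n \<rho> b)"
        by (rule sum.cong[OF refl], rule sum.swap)
      also have "\<dots> = (\<Sum>b<B. \<Sum>\<rho>\<in>keys. \<Sum>n=1..N. g n \<rho> b)"
        by (rule sum.swap)
      finally show ?thesis .
    qed
    then show ?thesis .
  qed
  also have "\<dots> = (\<Sum>b<B. w b * (\<Sum>\<rho>\<in>keys. card {n \<in> {1..N}. b \<in> active n (qry \<theta> n \<rho>)}))"
    by (simp add: sum.If_cases Int_def sum_distrib_left mult.commute)
  finally have "real (\<Sum>n=1..N. \<Sum>\<rho>\<in>keys. \<Sum>b\<in>active n (qry \<theta> n \<rho>). w b) =
      (\<Sum>b<B. real (w b) * real (\<Sum>\<rho>\<in>keys. card {n \<in> {1..N}. b \<in> active n (qry \<theta> n \<rho>)}))"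
    by simp
  also have "\<dots> = (\<Sum>b<B. real (w b) * ((real M - 1 / real M ^ (K - 1)) * real (card keys)))"
    using row by (intro sum.cong) auto
  also have "\<dots> = real (\<Sum>b<B. w b) * ((real M - 1 / real M ^ (K - 1)) * real (card keys))"
    by (simp add: sum_distrib_right)
  finally show ?thesis
    by (simp add: weight)
qed

section \<open>The scheme and its verification\<close>

text \<open>A sample point is a pair of files and key, so queries are independent of the files
  because they depend on the second component only.\<close>

definition scheme :: "'f::{finite,field} linear_pir_scheme" where
  "scheme = \<lparr>sample = uniform_count_measure (files \<times> keys), file_length = L,
     file_vec = (\<lambda>k \<omega>. fst \<omega> k), subpacketization = F,
     packet_coords = (\<lambda>k i. [off i..<off (Suc i)]), stored = stored_at,
     query = (\<lambda>\<theta> n \<omega>. qry \<theta> n (snd \<omega>)),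
     answer = (\<lambda>\<theta> n \<omega>. resp n (fst \<omega>) (qry \<theta> n (snd \<omega>)))\<rparr>"

lemma sample_scheme: "sample scheme = uniform_count_measure (files \<times> keys)"
  by (simp add: scheme_def)

lemma file_length_scheme: "file_length scheme = L"
  by (simp add: scheme_def)

lemma file_vec_scheme: "file_vec scheme k \<omega> = fst \<omega> k"
  by (simp add: scheme_def)

lemma subpacketization_scheme: "subpacketization scheme = F"
  by (simp add: scheme_def)

lemma packet_coords_scheme: "packet_coords scheme k i = [off i..<off (Suc i)]"
  by (simp add: scheme_def)

lemma stored_scheme: "stored scheme = stored_at"
  by (simp add: scheme_def)

lemma query_scheme: "query scheme \<theta> n \<omega> = qry \<theta> n (snd \<omega>)"
  by (simp add: scheme_def)

lemma answer_scheme: "answer scheme \<theta> n \<omega> = resp n (fst \<omega>) (qry \<theta> n (snd \<omega>))"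
  by (simp add: scheme_def)

lemmas scheme_simps [simp] =
  sample_scheme file_length_scheme file_vec_scheme subpacketization_scheme
  packet_coords_scheme stored_scheme query_scheme answer_scheme

lemma finite_sample: "finite (files \<times> keys :: ((nat \<Rightarrow> 'f::finite list) \<times> nat list) set)"
  by (intro finite_cartesian_product finite_files finite_with_sums)

lemma sample_nonempty: "files \<times> keys \<noteq> {}"
  using files_nonempty with_sums_nonempty by blast

lemma packet_scheme: "packet scheme k i \<omega> = map (\<lambda>c. fst \<omega> k ! c) [off i..<off (Suc i)]"
  by (simp add: packet_def)

lemma scheme_files: "files_uniform_independent K (scheme :: 'f::{finite,field} linear_pir_scheme)"
proof -
  have V: "finite (vectors L :: 'f list set)" "(vectors L :: 'f list set) \<noteq> {}"
    using finite_lists_length_eq[of "UNIV :: 'f set" L] Ex_list_of_length[of L]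
    by (auto simp: vectors_def)
  have I: "finite {1..K}" "{1..K} \<noteq> {}" using K by auto
  have vec: "file_vec scheme = (\<lambda>k \<omega>. fst \<omega> k)" by (simp add: scheme_def)
  show ?thesis
    unfolding files_uniform_independent_def vec scheme_simps files_def
    using indep_vars_uniform_PiE[OF I V finite_with_sums with_sums_nonempty] L_pos by blast
qed

text \<open>Exchanging two files preserves the uniform measure, so packets with the same number have
  the same entropy in both.\<close>

lemma bij_betw_swap_files:
  assumes "k \<in> {1..K}" "k' \<in> {1..K}"
  shows "bij_betw (\<lambda>(f, \<rho>). (f \<circ> Transposition.transpose k k', \<rho>)) (files \<times> R) (files \<times> R)"
proof (rule bij_betw_byWitness[where f' = "\<lambda>(f, \<rho>). (f \<circ> Transposition.transpose k k', \<rho>)"])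
  have "f \<circ> Transposition.transpose k k' \<in> files" if "f \<in> files" for f
    using that assms by (auto simp: files_def PiE_iff extensional_def Transposition.transpose_def)
  then show "(\<lambda>(f, \<rho>). (f \<circ> Transposition.transpose k k', \<rho>)) ` (files \<times> R) \<subseteq> files \<times> R"
    "(\<lambda>(f, \<rho>). (f \<circ> Transposition.transpose k k', \<rho>)) ` (files \<times> R) \<subseteq> files \<times> R"
    by auto
qed (auto simp: comp_assoc)

lemma scheme_packets: "valid_packets K (scheme :: 'f::{finite,field} linear_pir_scheme)"
  unfolding valid_packets_def
proof (intro conjI ballI)
  let ?S = "scheme :: 'f linear_pir_scheme"
  fix k assume k: "k \<in> {1..K}"
  show "disjoint_family_on (\<lambda>i. set (packet_coords ?S k i)) {1..subpacketization ?S}"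
  proof (unfold disjoint_family_on_def, intro ballI impI)
    fix i j assume ij: "i \<in> {1..subpacketization ?S}" "j \<in> {1..subpacketization ?S}" "i \<noteq> j"
    show "set (packet_coords ?S k i) \<inter> set (packet_coords ?S k j) = {}"
    proof (cases "i < j")
      case True
      then have "off (Suc i) \<le> off j" by (intro off_mono) simp
      then show ?thesis by auto
    next
      case False
      then have "off (Suc j) \<le> off i" using ij by (intro off_mono) simp
      then show ?thesis by auto
    qed
  qed
  show "(\<Union>i\<in>{1..subpacketization ?S}. set (packet_coords ?S k i)) = {..<file_length ?S}"
    using off_cover[of F] by (simp add: off_last)
  fix i assume i: "i \<in> {1..subpacketization ?S}"
  then have "off i < off (Suc i)"
    using w_pos[of "block_of i"] block_of_less[of i] by (simp add: off_Suc)
  then show "packet_coords ?S k i \<noteq> []" "distinct (packet_coords ?S k i)"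
    by simp_all
next
  let ?S = "scheme :: 'f linear_pir_scheme"
  fix i k k' assume k: "k \<in> {1..K}" "k' \<in> {1..K}"
  show "ent ?S (packet ?S k i) = ent ?S (packet ?S k' i)"
    unfolding ent_def scheme_simps space_uniform_count_measure
    by (rule entropy_uniform_bij_betw[OF finite_sample sample_nonempty bij_betw_swap_files[OF k(1,2)]])
      (auto simp: packet_scheme)
qed

text \<open>The entropy is at most the logarithm of the number of values. The packets stored at a
  server have \<open>K * ((M - 1) * M)\<close> symbols in total, which is
  \<open>M / N * K * L\<close> as \<open>L = N * (M - 1)\<close>.\<close>

lemma scheme_storage: "valid_storage (real M / real N) N K (scheme :: 'f::{finite,field} linear_pir_scheme)"
  unfolding valid_storage_def
proof (intro conjI ballI)
  let ?S = "scheme :: 'f linear_pir_scheme"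
  fix n assume n: "n \<in> {1..N}"
  show "stored ?S n \<subseteq> {1..subpacketization ?S}"
    by (auto simp: stored_at_def)
  let ?\<Omega> = "files \<times> keys :: ((nat \<Rightarrow> 'f list) \<times> nat list) set"
  let ?I = "{1..K} \<times> stored_at n"
  let ?V = "\<Pi>\<^sub>E p\<in>?I. {v :: 'f list. length v = w (block_of (snd p))}"
  have fin: "finite {v :: 'f list. length v = m}" for m
    using finite_lists_length_eq[of "UNIV :: 'f set" m] by simp
  have "storage ?S K n ` ?\<Omega> \<subseteq> ?V"
  proof (rule image_subsetI)
    fix \<omega> :: "(nat \<Rightarrow> 'f list) \<times> nat list"
    have "length (packet ?S k i \<omega>) = w (block_of i)" if "i \<in> stored_at n" for k i
      using that by (simp add: packet_scheme stored_at_def off_Suc)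
    then show "storage ?S K n \<omega> \<in> ?V"
      unfolding storage_def scheme_simps by (intro restrict_PiE_iff[THEN iffD2]) auto
  qed
  moreover have finV: "finite ?V"
    using fin finite_stored_at by (intro finite_PiE) auto
  ultimately have "card (storage ?S K n ` ?\<Omega>) \<le> card ?V"
    by (intro card_mono)
  also have "card ?V = (\<Prod>p\<in>?I. CARD('f) ^ w (block_of (snd p)))"
    using finite_stored_at card_lists_length_eq[of "UNIV :: 'f set"] by (simp add: card_PiE)
  also have "\<dots> = CARD('f) ^ (\<Sum>p\<in>?I. w (block_of (snd p)))"
    by (simp add: power_sum)
  also have "(\<Sum>p\<in>?I. w (block_of (snd p))) = K * (\<Sum>i\<in>stored_at n. w (block_of i))"
  proof -
    have "(\<Sum>p\<in>?I. w (block_of (snd p))) = (\<Sum>k\<in>{1..K}. \<Sum>i\<in>stored_at n. w (block_of i))"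
      unfolding sum.cartesian_product by (simp add: case_prod_unfold)
    then show ?thesis by simp
  qed
  also have "(\<Sum>i\<in>stored_at n. w (block_of i)) = (\<Sum>i\<in>{1..F}. if n \<in> blk (block_of i) then w (block_of i) else 0)"
    by (simp add: sum.If_cases stored_at_def Int_def)
  also have "\<dots> = (M - 1) * M"
    using load[OF n] sum_block_of[of "\<lambda>b. if n \<in> blk b then w b else 0"] by simp
  finally have "ent ?S (storage ?S K n) \<le> log (real CARD('f)) (real (CARD('f) ^ (K * ((M - 1) * M))))"
    unfolding ent_def scheme_simps space_uniform_count_measure
    by (intro entropy_uniform_le finite_sample sample_nonempty card_field_gt_1)
  also have "\<dots> = real (K * ((M - 1) * M))"
    using card_field_gt_1[where 'f = 'f] by simp
  also have "\<dots> = real M / real N * real K * real (file_length ?S)"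
    using N by (simp add: L_def)
  finally show "ent ?S (storage ?S K n) \<le> real M / real N * real K * real (file_length ?S)" .
next
  let ?S = "scheme :: 'f linear_pir_scheme"
  fix i assume i: "i \<in> {1..subpacketization ?S}"
  then have b: "block_of i < B" using block_of_less by simp
  then have "blk (block_of i) \<noteq> {}"
    using bij_betw_same_card[OF pos[OF b]] M by auto
  then show "\<exists>n\<in>{1..N}. i \<in> stored ?S n"
    using blk[OF b] i by (force simp: stored_at_def)
qed

text \<open>Replacing the key by the query to server \<open>n\<close> is a bijection onto a space
  that does not involve \<open>\<theta>\<close>, and query, answer and storage are functions on it.
  So both distributions equal a common third one.\<close>

lemma scheme_private: "private_retrieval N K (scheme :: 'f::{finite,field} linear_pir_scheme)"
  unfolding private_retrieval_def
proof (intro ballI)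
  let ?S = "scheme :: 'f linear_pir_scheme"
  fix n \<theta> \<theta>' assume \<theta>: "\<theta> \<in> {1..K}" "\<theta>' \<in> {1..K}"
  have "distr (sample ?S) (count_space UNIV)
        (\<lambda>\<omega>. (query ?S \<theta> n \<omega>, answer ?S \<theta> n \<omega>, storage ?S K n \<omega>)) =
      distr (uniform_count_measure (files \<times> with_sums (shift_of n))) (count_space UNIV)
        (\<lambda>(f, x). (x, resp n f x, storage ?S K n (f, x)))"
    if \<theta>: "\<theta> \<in> {1..K}" for \<theta>
    unfolding scheme_simps
  proof (rule distr_uniform_bij_betw[OF finite_sample, where \<tau> = "\<lambda>(f, \<rho>). (f, qry \<theta> n \<rho>)"])
    show "bij_betw (\<lambda>(f, \<rho>). (f, qry \<theta> n \<rho>)) (files \<times> keys) (files \<times> with_sums (shift_of n))"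
    proof -
      have "bij_betw (map_prod id (qry \<theta> n)) (files \<times> keys) (files \<times> with_sums (shift_of n))"
        using bij_betw_qry[OF \<theta>, of n] by (intro bij_betw_map_prod) auto
      then show ?thesis
        by (simp add: map_prod_def)
    qed
    fix \<omega> :: "(nat \<Rightarrow> 'f list) \<times> nat list"
    show "(qry \<theta> n (snd \<omega>), resp n (fst \<omega>) (qry \<theta> n (snd \<omega>)), storage ?S K n \<omega>) =
        (\<lambda>(f, x). (x, resp n f x, storage ?S K n (f, x))) ((\<lambda>(f, \<rho>). (f, qry \<theta> n \<rho>)) \<omega>)"
      by (cases \<omega>) (simp add: storage_def packet_scheme)
  qed simp
  then show "distr (sample ?S) (count_space UNIV)
        (\<lambda>\<omega>. (query ?S \<theta> n \<omega>, answer ?S \<theta> n \<omega>, storage ?S K n \<omega>)) =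
      distr (sample ?S) (count_space UNIV)
        (\<lambda>\<omega>. (query ?S \<theta>' n \<omega>, answer ?S \<theta>' n \<omega>, storage ?S K n \<omega>))"
    using \<theta> by simp
qed

lemma scheme_linear: "linear_scheme N K (scheme :: 'f::{finite,field} linear_pir_scheme)"
proof -
  let ?S = "scheme :: 'f linear_pir_scheme"
  \<comment> \<open>Combinations are numbered from 1, so combination \<open>j\<close> belongs to row
    \<open>j - 1\<close>. Coefficient 1 picks the packet named by the entry of column
    \<open>k\<close>; entry 0 picks none since \<open>sub_of\<close> is positive.\<close>
  define \<beta> where "\<beta> n x k i j = (if block_of i = j - 1 \<and> sub_of i = ent_of x (j - 1) k then 1 else 0 :: 'f)"
    for n :: nat and x k i j
  have width: "Max (insert 0 ((\<lambda>(k, i). length (packet_coords ?S k i)) ` ({1..K} \<times> stored ?S n))) = width n" for n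
  proof -
    have "(\<lambda>(k, i). length (packet_coords ?S k i)) ` ({1..K} \<times> stored ?S n) =
        (\<lambda>(k, i). w (block_of i)) ` ({1..K} \<times> stored_at n)"
      by (intro image_cong) (auto simp: stored_at_def off_Suc)
    then show ?thesis by (simp add: width_def)
  qed
  \<comment> \<open>At most one stored packet of each file has a nonzero coefficient, so the sum
    collapses to one zero-padded packet or to 0.\<close>
  have coeff: "(\<Sum>i\<in>stored_at n. \<beta> n x k i (Suc b) * nth_default 0 (packet ?S k i \<omega>) t) =
      (if n \<in> blk b then part (fst \<omega>) b k (ent_of x b k) t else 0)"
    if x: "x \<in> matrices" and b: "b < B" and k: "k \<in> {1..K}" for n x k b t \<omega>
  proof (cases "n \<in> blk b \<and> 0 < ent_of x b k")
    case True
    let ?i = "idx b (ent_of x b k)"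
    note pos_lt = conjunct2[OF True] ent_of_less[OF x b k]
    note i = idx_mem[OF b pos_lt] block_of_idx[OF pos_lt] sub_of_idx[OF pos_lt]
    have only: "\<beta> n x k i (Suc b) * nth_default 0 (packet ?S k i \<omega>) t =
        (if i = ?i then nth_default 0 (packet ?S k ?i \<omega>) t else 0)" if "i \<in> stored_at n" for i
    proof -
      have "i \<in> {1..F}" using that by (simp add: stored_at_def)
      then have "block_of i = b \<and> sub_of i = ent_of x b k \<longleftrightarrow> i = ?i"
        using i idx_block_of_sub_of by metis
      then show ?thesis by (simp add: \<beta>_def)
    qed
    have "?i \<in> stored_at n"
      using i True by (simp add: stored_at_def)
    then have "(\<Sum>i\<in>stored_at n. \<beta> n x k i (Suc b) * nth_default 0 (packet ?S k i \<omega>) t) =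
        nth_default 0 (packet ?S k ?i \<omega>) t"
      using finite_stored_at by (simp add: only cong: sum.cong)
    also have "\<dots> = part (fst \<omega>) b k (ent_of x b k) t"
      using True i by (simp add: packet_scheme part_def nth_default_def off_Suc)
    finally show ?thesis using True by simp
  next
    case False
    have "\<beta> n x k i (Suc b) = 0" if "i \<in> stored_at n" for i
      using that False by (auto simp: \<beta>_def stored_at_def sub_of_def)
    then show ?thesis using False by (auto simp: part_def)
  qed
  show ?thesis
    unfolding linear_scheme_def
  proof (intro exI[of _ "\<lambda>_ _. B"] exI[of _ \<beta>] ballI)
    fix \<theta> n \<omega> assume \<theta>: "\<theta> \<in> {1..K}" and "\<omega> \<in> space (sample ?S)"
    then have x: "qry \<theta> n (snd \<omega>) \<in> matrices"
      by (intro qry_in) (auto simp: space_uniform_count_measure)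
    have row: "lin_comb K ?S n (\<lambda>k i. \<beta> n (qry \<theta> n (snd \<omega>)) k i (Suc b)) \<omega> =
        map (\<lambda>t. if n \<in> blk b then comb (fst \<omega>) (qry \<theta> n (snd \<omega>)) b t else 0) [0..<width n]"
      if "b < B" for b
      unfolding lin_comb_def width
      using coeff[OF x that] by (simp add: comb_def)
    have "[1..<B + 1] = map Suc [0..<B]"
      by (simp add: map_Suc_upt)
    then show "answer ?S \<theta> n \<omega> = map (\<lambda>j. lin_comb K ?S n (\<lambda>k i. \<beta> n (query ?S \<theta> n \<omega>) k i j) \<omega>) [1..<B + 1]"
      using row by (simp add: resp_def)
  qed
qed

text \<open>The combinations of a server use only packets of blocks containing it, all of which it
  stores.\<close>

lemma answer_determined:
  assumes "storage (scheme :: 'f::{finite,field} linear_pir_scheme) K n (f, \<rho>) = storage scheme K n (f', \<rho>')"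
    and x: "x \<in> matrices"
  shows "resp n f x = resp n f' x"
  unfolding resp_eq_iff
proof (intro allI impI)
  let ?S = "scheme :: 'f linear_pir_scheme"
  fix b t assume b: "b < B" "n \<in> blk b" and t: "t < w b"
  have "part f b k (ent_of x b k) t = part f' b k (ent_of x b k) t" if k: "k \<in> {1..K}" for k
  proof (cases "0 < ent_of x b k")
    case True
    note pos_lt = True ent_of_less[OF x b(1) k]
    note i = idx_mem[OF b(1) pos_lt] block_of_idx[OF pos_lt]
    let ?i = "idx b (ent_of x b k)"
    have "?i \<in> stored_at n" using i b by (simp add: stored_at_def)
    then have "packet ?S k ?i (f, \<rho>) = packet ?S k ?i (f', \<rho>')"
      using fun_cong[OF assms(1), of "(k, ?i)"] k by (simp add: storage_def)
    then have "packet ?S k ?i (f, \<rho>) ! t = packet ?S k ?i (f', \<rho>') ! t" by simp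
    then show ?thesis
      using t i by (simp add: packet_scheme part_def off_Suc)
  qed (simp add: part_def)
  then show "comb f x b t = comb f' x b t"
    unfolding comb_def by (intro sum.cong) auto
qed

text \<open>By \<open>decode\<close> each coordinate of the desired file is a difference of two
  answer symbols.\<close>

lemma file_determined:
  assumes \<rho>: "\<rho> \<in> keys" and \<theta>: "\<theta> \<in> {1..K}" and f: "f \<in> files" "f' \<in> files"
    and eq: "\<And>n. n \<in> {1..N} \<Longrightarrow> resp n f (qry \<theta> n \<rho>) = resp n f' (qry \<theta> n \<rho>)"
  shows "f \<theta> = (f' \<theta> :: 'f::{finite,field} list)"
proof (rule nth_equalityI)
  have len: "length (f \<theta>) = L" "length (f' \<theta>) = L"
    using f[unfolded files_def, THEN PiE_mem, OF \<theta>] by (simp_all add: vectors_def)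
  then show "length (f \<theta>) = length (f' \<theta>)" by simp
  fix l assume "l < length (f \<theta>)"
  then have "l < L" using len by simp
  then obtain b s t where l: "b < B" "0 < s" "s < M" "t < w b" "l = off (idx b s) + t"
    by (rule coordinate_cases)
  obtain n n' where n: "n \<in> blk b" "n' \<in> blk b"
    and dec: "\<And>f :: nat \<Rightarrow> 'f list.
      comb f (qry \<theta> n \<rho>) b t - comb f (qry \<theta> n' \<rho>) b t = f \<theta> ! (off (idx b s) + t)"
    using decode[OF \<rho> \<theta> l(1-4), where 'f = 'f] by blast
  have "comb f (qry \<theta> m \<rho>) b t = comb f' (qry \<theta> m \<rho>) b t" if "m \<in> blk b" for m
  proof -
    have "m \<in> {1..N}" using blk[OF l(1)] that by blast
    from eq[OF this] show ?thesis
      using that l(1,4) by (simp add: resp_eq_iff)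
  qed
  then show "f \<theta> ! l = f' \<theta> ! l"
    using n dec[of f] dec[of f'] l(5) by simp
qed

lemma scheme_retrieval: "valid_retrieval N K (scheme :: 'f::{finite,field} linear_pir_scheme)"
  unfolding valid_retrieval_def
proof (intro ballI conjI)
  let ?S = "scheme :: 'f linear_pir_scheme"
  fix \<theta> assume \<theta>: "\<theta> \<in> {1..K}"
  note det = conditional_entropy_uniform_eq_0[OF finite_sample sample_nonempty card_field_gt_1]
  show "mut_inf ?S (all_queries ?S N \<theta>) (all_files ?S K) = 0"
    unfolding mut_inf_def scheme_simps space_uniform_count_measure
    by (rule mutual_information_uniform_eq_0[OF finite_files files_nonempty finite_with_sums
          with_sums_nonempty card_field_gt_1,
          where f = "\<lambda>f. restrict f {1..K}" and g = "\<lambda>\<rho>. restrict (\<lambda>n. qry \<theta> n \<rho>) {1..N}"])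
      (simp_all add: all_files_def all_queries_def)
  show "cond_ent ?S (file_vec ?S \<theta>) (\<lambda>\<omega>. (all_answers ?S N \<theta> \<omega>, all_queries ?S N \<theta> \<omega>)) = 0"
    unfolding cond_ent_def scheme_simps(1) space_uniform_count_measure
  proof (rule det)
    fix \<omega> \<omega>' :: "(nat \<Rightarrow> 'f list) \<times> nat list"
    assume \<omega>: "\<omega> \<in> files \<times> keys" "\<omega>' \<in> files \<times> keys"
      and eq: "(all_answers ?S N \<theta> \<omega>, all_queries ?S N \<theta> \<omega>) = (all_answers ?S N \<theta> \<omega>', all_queries ?S N \<theta> \<omega>')"
    \<comment> \<open>The keys may differ, but the queries coincide, so both answers are answers to
      the queries of the first key.\<close>
    have "resp n (fst \<omega>) (qry \<theta> n (snd \<omega>)) = resp n (fst \<omega>') (qry \<theta> n (snd \<omega>))" if n: "n \<in> {1..N}" for n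
    proof -
      have "all_answers ?S N \<theta> \<omega> n = all_answers ?S N \<theta> \<omega>' n" "all_queries ?S N \<theta> \<omega> n = all_queries ?S N \<theta> \<omega>' n"
        using eq by simp_all
      then show ?thesis using n by (simp add: all_answers_def all_queries_def)
    qed
    then have "fst \<omega> \<theta> = fst \<omega>' \<theta>"
      using \<omega> \<theta> by (intro file_determined[where \<rho> = "snd \<omega>"]) auto
    then show "file_vec ?S \<theta> \<omega> = file_vec ?S \<theta> \<omega>'" by simp
  qed
  fix n assume n: "n \<in> {1..N}"
  show "simple_function (sample ?S) (query ?S \<theta> n)" "simple_function (sample ?S) (answer ?S \<theta> n)"
    unfolding scheme_simps(1) by (intro simple_function_uniform finite_sample)+
  show "cond_ent ?S (answer ?S \<theta> n) (\<lambda>\<omega>. (query ?S \<theta> n \<omega>, storage ?S K n \<omega>)) = 0"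
    unfolding cond_ent_def scheme_simps(1) space_uniform_count_measure
  proof (rule det)
    fix \<omega> \<omega>' :: "(nat \<Rightarrow> 'f list) \<times> nat list"
    assume \<omega>: "\<omega> \<in> files \<times> keys" "\<omega>' \<in> files \<times> keys"
      and eq: "(query ?S \<theta> n \<omega>, storage ?S K n \<omega>) = (query ?S \<theta> n \<omega>', storage ?S K n \<omega>')"
    have "qry \<theta> n (snd \<omega>) \<in> matrices"
      using \<omega> \<theta> by (intro qry_in) auto
    then have "resp n (fst \<omega>) (qry \<theta> n (snd \<omega>)) = resp n (fst \<omega>') (qry \<theta> n (snd \<omega>))"
      using eq by (intro answer_determined[where \<rho> = "snd \<omega>" and \<rho>' = "snd \<omega>'"]) simp_all
    then show "answer ?S \<theta> n \<omega> = answer ?S \<theta> n \<omega>'"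
      using eq by simp
  qed
qed

text \<open>By \<open>card_resp_fibre\<close>, fixing the answer divides the number of file tuples
  by \<open>q ^ e\<close>, with \<open>e\<close> the total weight of the active rows. So a sample
  point contributes exactly \<open>e\<close>, which is averaged over the keys.\<close>

lemma answer_entropy:
  assumes \<theta>: "\<theta> \<in> {1..K}"
  shows "cond_ent (scheme :: 'f::{finite,field} linear_pir_scheme) (answer scheme \<theta> n) (query scheme \<theta> n) =
    real (\<Sum>\<rho>\<in>keys. \<Sum>b\<in>active n (qry \<theta> n \<rho>). w b) / real (card keys)"
proof -
  let ?S = "scheme :: 'f linear_pir_scheme"
  let ?files = "files :: (nat \<Rightarrow> 'f list) set"
  let ?\<Omega> = "?files \<times> keys"
  let ?q = "real CARD('f)"
  let ?e = "\<lambda>\<rho>. \<Sum>b\<in>active n (qry \<theta> n \<rho>). w b"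
  let ?X = "answer ?S \<theta> n" and ?Y = "query ?S \<theta> n"
  have ratio: "log ?q (real (card (fibre ?\<Omega> ?Y (?Y \<omega>))) /
      real (card (fibre ?\<Omega> (\<lambda>\<omega>. (?X \<omega>, ?Y \<omega>)) (?X \<omega>, ?Y \<omega>)))) = real (?e (snd \<omega>))"
    if mem: "\<omega> \<in> ?\<Omega>" for \<omega>
  proof -
    obtain f \<rho> where \<omega>: "\<omega> = (f, \<rho>)" "f \<in> ?files" "\<rho> \<in> keys" using mem by auto
    let ?G = "{g \<in> ?files. resp n g (qry \<theta> n \<rho>) = resp n f (qry \<theta> n \<rho>)}"
    let ?R = "{\<rho>' \<in> keys. qry \<theta> n \<rho>' = qry \<theta> n \<rho>}"
    \<comment> \<open>Both fibres have the same set of keys as a factor, which cancels from the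
      ratio.\<close>
    have "fibre ?\<Omega> ?Y (?Y \<omega>) = ?files \<times> ?R"
      "fibre ?\<Omega> (\<lambda>\<omega>. (?X \<omega>, ?Y \<omega>)) (?X \<omega>, ?Y \<omega>) = ?G \<times> ?R"
      using \<omega>(1) by (auto simp: fibre_def)
    moreover have "card ?files = card ?G * CARD('f) ^ ?e \<rho>"
      using card_resp_fibre[OF qry_in[OF \<theta> \<omega>(3)] \<omega>(2)] by simp
    moreover have "card ?R > 0" "card ?G > 0"
      using \<omega> finite_with_sums finite_files[where 'f = 'f] by (auto simp: card_gt_0_iff)
    ultimately have "real (card (fibre ?\<Omega> ?Y (?Y \<omega>))) /
      real (card (fibre ?\<Omega> (\<lambda>\<omega>. (?X \<omega>, ?Y \<omega>)) (?X \<omega>, ?Y \<omega>))) = ?q ^ ?e \<rho>"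
      by (simp add: card_cartesian_product)
    then show ?thesis
      using card_field_gt_1[where 'f = 'f] \<omega>(1) by simp
  qed
  have "cond_ent ?S ?X ?Y = (\<Sum>\<omega>\<in>?\<Omega>. real (?e (snd \<omega>))) / real (card ?\<Omega>)"
    unfolding cond_ent_def scheme_simps(1) space_uniform_count_measure
    by (subst conditional_entropy_uniform[OF finite_sample sample_nonempty card_field_gt_1])
      (simp only: ratio cong: sum.cong)
  also have "(\<Sum>\<omega>\<in>?\<Omega>. real (?e (snd \<omega>))) = real (card ?files) * (\<Sum>\<rho>\<in>keys. real (?e \<rho>))"
  proof -
    have "(\<Sum>\<omega>\<in>?\<Omega>. real (?e (snd \<omega>))) = (\<Sum>f\<in>?files. \<Sum>\<rho>\<in>keys. real (?e \<rho>))"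
      unfolding sum.cartesian_product by (simp add: case_prod_unfold)
    then show ?thesis by simp
  qed
  finally have "cond_ent ?S ?X ?Y =
      real (card ?files) * (\<Sum>\<rho>\<in>keys. real (?e \<rho>)) / (real (card ?files) * real (card keys))"
    by (simp only: card_cartesian_product of_nat_mult)
  moreover have "card ?files > 0"
    using finite_files[where 'f = 'f] files_nonempty by (simp add: card_gt_0_iff)
  ultimately show ?thesis
    by (simp del: scheme_simps)
qed

text \<open>The download is \<open>N * (M - 1 / M ^ (K - 1))\<close> for \<open>N * (M - 1)\<close>
  symbols; summing the geometric series in the capacity gives the same ratio.\<close>

lemma scheme_capacity: "capacity_achieving M N K (scheme :: 'f::{finite,field} linear_pir_scheme)"
  unfolding capacity_achieving_def
proof
  let ?S = "scheme :: 'f linear_pir_scheme"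
  fix \<theta> assume \<theta>: "\<theta> \<in> {1..K}"
  have keys: "real (card keys) > 0"
    using finite_with_sums with_sums_nonempty by (simp add: card_gt_0_iff)
  have "download_cost N ?S \<theta> =
      real (\<Sum>n=1..N. \<Sum>\<rho>\<in>keys. \<Sum>b\<in>active n (qry \<theta> n \<rho>). w b) / real (card keys)"
    unfolding download_cost_def answer_entropy[OF \<theta>] by (simp add: sum_divide_distrib)
  also have "\<dots> = real N * (real M - 1 / real M ^ (K - 1))"
    unfolding sum_active_weights[OF \<theta>] using keys by simp
  finally have D: "download_cost N ?S \<theta> = real N * (real M - 1 / real M ^ (K - 1))" .
  have "(\<Sum>m<K. 1 / real M ^ m) = (\<Sum>m<K. (1 / real M) ^ m)"
    by (simp add: power_one_over)
  also have "\<dots> = (1 - (1 / real M) ^ K) / (1 - 1 / real M)"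
    using M by (subst sum_gp_strict) simp
  also have "\<dots> = (real M - 1 / real M ^ (K - 1)) / real (M - 1)"
  proof -
    have "(1 / real M) ^ K * real M = 1 / real M ^ (K - 1)"
      using K M by (cases K) (simp_all add: power_one_over field_simps)
    then have "(1 - (1 / real M) ^ K) * real M = real M - 1 / real M ^ (K - 1)"
      by (simp add: algebra_simps)
    moreover have "(1 - 1 / real M) * real M = real (M - 1)"
      using M by (simp add: algebra_simps of_nat_diff)
    moreover have "(1 - (1 / real M) ^ K) / (1 - 1 / real M) =
        ((1 - (1 / real M) ^ K) * real M) / ((1 - 1 / real M) * real M)"
      using M by simp
    ultimately show ?thesis by simp
  qed
  finally show "retrieval_rate N ?S \<theta> = pir_capacity M K"
    using N unfolding retrieval_rate_def pir_capacity_def D by (simp add: L_def)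
qed

lemma scheme_valid: "sc_pir_scheme (real M / real N) N K (scheme :: 'f::{finite,field} linear_pir_scheme)"
  unfolding sc_pir_scheme_def scheme_simps(1)
  using prob_space_uniform_count_measure[OF finite_sample sample_nonempty] scheme_files scheme_packets
    scheme_storage scheme_retrieval scheme_private by blast

end

section \<open>Balanced block designs\<close>

text \<open>An \<open>M\<close>-uniform weighted hypergraph in which every vertex has weighted
  degree \<open>M\<close>. Vertices start from 0, unlike servers.\<close>

definition balanced_design :: "nat \<Rightarrow> nat \<Rightarrow> nat \<Rightarrow> (nat \<Rightarrow> nat set) \<Rightarrow> (nat \<Rightarrow> nat) \<Rightarrow> bool" where
  "balanced_design N M B blk w \<longleftrightarrow>
     (\<forall>b<B. blk b \<subseteq> {..<N} \<and> card (blk b) = M \<and> 0 < w b) \<and>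
     (\<forall>n<N. (\<Sum>b<B. if n \<in> blk b then w b else 0) = M)"

text \<open>Weighted incidences are counted twice: \<open>N * M\<close> by vertices, and
  \<open>M\<close> times the total weight by blocks.\<close>

lemma balanced_design_weight:
  assumes "balanced_design N M B blk w" and "M > 0"
  shows "(\<Sum>b<B. w b) = N"
proof -
  have "N * M = (\<Sum>n<N. \<Sum>b<B. if n \<in> blk b then w b else 0)"
    using assms by (simp add: balanced_design_def)
  also have "\<dots> = (\<Sum>b<B. \<Sum>n<N. if n \<in> blk b then w b else 0)"
    by (rule sum.swap)
  also have "\<dots> = (\<Sum>b<B. M * w b)"
  proof (rule sum.cong[OF refl])
    fix b assume "b \<in> {..<B}"
    then have "blk b \<subseteq> {..<N}" "card (blk b) = M"
      using assms by (auto simp: balanced_design_def)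
    then show "(\<Sum>n<N. if n \<in> blk b then w b else 0) = M * w b"
      by (simp add: sum.If_cases Int_absorb1)
  qed
  finally show ?thesis
    using \<open>M > 0\<close> by (simp add: sum_distrib_left[symmetric] mult.commute)
qed

text \<open>The blocks avoiding a vertex have weight \<open>N - M\<close>, because the total weight
  is \<open>N\<close>.\<close>

lemma balanced_design_complement:
  assumes "balanced_design N M B blk w" and "M > 0" "M \<le> N"
  shows "balanced_design N (N - M) B (\<lambda>b. {..<N} - blk b) w"
proof -
  have "(\<Sum>b<B. if n \<in> {..<N} - blk b then w b else 0) = N - M" if "n < N" for n
  proof -
    have "(\<Sum>b<B. if n \<in> {..<N} - blk b then w b else 0) + (\<Sum>b<B. if n \<in> blk b then w b else 0) =
        (\<Sum>b<B. w b)"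
      unfolding sum.distrib[symmetric] using that by (intro sum.cong) auto
    moreover have "(\<Sum>b<B. if n \<in> blk b then w b else 0) = M"
      using assms that by (simp add: balanced_design_def)
    ultimately show ?thesis
      using balanced_design_weight[OF assms(1,2)] by simp
  qed
  moreover have "card ({..<N} - blk b) = N - M" if "b < B" for b
  proof -
    have "blk b \<subseteq> {..<N}" "card (blk b) = M"
      using assms that by (auto simp: balanced_design_def)
    then show ?thesis
      by (simp add: card_Diff_subset finite_subset)
  qed
  ultimately show ?thesis
    using assms by (auto simp: balanced_design_def)
qed

text \<open>The new block consists of new vertices only, so old loads are unchanged and each new
  vertex gets load \<open>M\<close> from this block alone.\<close>

lemma balanced_design_extend:
  assumes "balanced_design N M B blk w" and "M > 0"
  shows "balanced_design (N + M) M (Suc B) (blk(B := {N..<N + M})) (w(B := M))"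
proof -
  let ?blk = "blk(B := {N..<N + M})" and ?w = "w(B := M)"
  have sum: "(\<Sum>b<B. if n \<in> blk b then ?w b else 0) = (\<Sum>b<B. if n \<in> blk b then w b else 0)" for n
    by (intro sum.cong) auto
  have "(\<Sum>b<Suc B. if n \<in> ?blk b then ?w b else 0) = M" if "n < N + M" for n
  proof (cases "n < N")
    case True show ?thesis
      using assms(1) True sum[of n] by (simp add: balanced_design_def del: sum_eq_0_iff)
  next
    case False
    then have "(\<Sum>b<B. if n \<in> blk b then w b else 0) = 0"
      using assms(1) by (intro sum.neutral) (auto simp: balanced_design_def)
    then show ?thesis
      using False that sum[of n] by (simp del: sum_eq_0_iff)
  qed
  moreover have "?blk b \<subseteq> {..<N + M} \<and> card (?blk b) = M \<and> 0 < ?w b" if "b < Suc B" for b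
  proof (cases "b = B")
    case True
    then show ?thesis using \<open>M > 0\<close> by auto
  next
    case False
    then have "blk b \<subseteq> {..<N} \<and> card (blk b) = M \<and> 0 < w b"
      using assms(1) that by (simp add: balanced_design_def)
    moreover have "{..<N} \<subseteq> {..<N + M}" by auto
    ultimately show ?thesis using False by auto
  qed
  ultimately show ?thesis
    unfolding balanced_design_def by blast
qed

lemma balanced_design_extend_many:
  assumes "balanced_design N M B blk w" and "M > 0"
  shows "\<exists>blk w. balanced_design (N + e * M) M (B + e) blk w"
proof (induction e)
  case 0
  then show ?case using assms(1) by auto
next
  case (Suc e)
  then obtain blk w where "balanced_design (N + e * M) M (B + e) blk w" by blast
  from balanced_design_extend[OF this \<open>M > 0\<close>] show ?case
    by (auto simp: add_ac)
qed

section \<open>Designs with blocks of size \<open>m\<close> on \<open>2 * m + 1\<close>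
  points\<close>

text \<open>Set \<open>i\<close> misses just the point \<open>a + i\<close> of the interval, so each
  of the first \<open>r\<close> points is missed once and the others never. These sets will be the
  blocks of weight 2.\<close>

lemma sum_punctured_interval:
  fixes a c n r :: nat
  assumes "a + r \<le> c"
  shows "(\<Sum>i<r. if n \<in> {a..<c} - {a + i} then 2 else 0) =
    (if n < a \<or> c \<le> n then 0 else if n < a + r then 2 * (r - 1) else 2 * r :: nat)"
proof -
  consider "n < a \<or> c \<le> n" | "a \<le> n" "n < a + r" "n < c" | "a + r \<le> n" "n < c"
    using assms by linarith
  then show ?thesis
  proof cases
    case 1
    then show ?thesis by auto
  next
    case 2
    then have "(\<Sum>i<r. if n \<in> {a..<c} - {a + i} then 2 else 0) = (\<Sum>i<r. if i = n - a then 0 else 2 :: nat)"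
      by (intro sum.cong) auto
    also have "\<dots> = (\<Sum>i\<in>{..<r} - {n - a}. 2)"
      by (subst sum.If_cases) (auto simp: Diff_eq)
    also have "\<dots> = 2 * (r - 1)"
    proof -
      have "n - a \<in> {..<r}" using 2 by auto
      then show ?thesis by (simp add: card_Diff_singleton)
    qed
    finally show ?thesis using 2 by simp
  next
    case 3
    then have "(\<Sum>i<r. if n \<in> {a..<c} - {a + i} then 2 else 0) = (\<Sum>i<r. 2 :: nat)"
      by (intro sum.cong) auto
    then show ?thesis using 3 by simp
  qed
qed

text \<open>
  Servers below \<open>2 * r\<close> lie in the heavy block 0 and one block of weight 1; the other servers avoid
  block 0 and lie in all blocks of weight 2, or in all but one of these and in both blocks of
  weight 1.
\<close>

lemma balanced_design_even:
  assumes "r \<ge> 1"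
  shows "balanced_design (4 * r + 1) (2 * r) (r + 3)
    (\<lambda>b. if b = 0 then {..<2 * r} else if b = 1 then {..<r} \<union> {2 * r..<3 * r}
         else if b = 2 then {r..<3 * r} else {2 * r..<4 * r + 1} - {2 * r + (b - 3)})
    (\<lambda>b. if b = 0 then 2 * r - 1 else if b \<le> 2 then 1 else 2)"
    (is "balanced_design _ _ _ ?blk ?w")
proof -
  have "(\<Sum>b<r + 3. if n \<in> ?blk b then ?w b else 0) = 2 * r" if "n < 4 * r + 1" for n
  proof -
    have 1: "(\<Sum>b<r + 3. f b) = f 0 + f 1 + f 2 + (\<Sum>i<r. f (i + 3))" for f :: "nat \<Rightarrow> nat"
      unfolding numeral_3_eq_3 add_Suc_right add_0_right sum.lessThan_Suc_shift
      by (simp add: numeral_2_eq_2)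
    have "(\<Sum>i<r. if n \<in> ?blk (i + 3) then ?w (i + 3) else 0) =
        (\<Sum>i<r. if n \<in> {2 * r..<4 * r + 1} - {2 * r + i} then 2 else 0)"
      by (intro sum.cong) auto
    also have "\<dots> = (if n < 2 * r then 0 else if n < 3 * r then 2 * (r - 1) else 2 * r)"
      using that by (subst sum_punctured_interval) auto
    finally have 2: "(\<Sum>i<r. if n \<in> ?blk (i + 3) then ?w (i + 3) else 0) = \<dots>" .
    \<comment> \<open>The loads are, in this order, \<open>(2 * r - 1) + 1\<close> with block 1, the
      same with block 2, \<open>1 + 1 + 2 * (r - 1)\<close>, and \<open>2 * r\<close>.\<close>
    consider "n < r" | "r \<le> n" "n < 2 * r" | "2 * r \<le> n" "n < 3 * r" | "3 * r \<le> n"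
      by linarith
    then show ?thesis
      unfolding 1 2 using assms that by cases simp_all
  qed
  moreover have "?blk b \<subseteq> {..<4 * r + 1} \<and> card (?blk b) = 2 * r \<and> 0 < ?w b" if "b < r + 3" for b
  proof -
    have card1: "card ({..<r} \<union> {2 * r..<3 * r}) = 2 * r"
      by (subst card_Un_disjoint) auto
    have card2: "card ({2 * r..<4 * r + 1} - {2 * r + (b - 3)}) = 2 * r" if "3 \<le> b"
      using that \<open>b < r + 3\<close> by (subst card_Diff_singleton) auto
    consider "b = 0" | "b = 1" | "b = 2" | "3 \<le> b" by linarith
    then show ?thesis
    proof cases
      case 2
      then show ?thesis using card1 by auto
    next
      case 4
      then show ?thesis using card2 by auto
    qed (use assms in auto)
  qed
  ultimately show ?thesis
    unfolding balanced_design_def by blast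
qed

text \<open>
  As before, with three blocks of weight 1: outside block 0, a server lies in all blocks of weight 2
  and one block of weight 1, or in all but one of the former and all of the latter.
\<close>

lemma balanced_design_odd:
  assumes "r \<ge> 1"
  shows "balanced_design (4 * r + 3) (2 * r + 1) (r + 4)
    (\<lambda>b. if b = 0 then {..<2 * r + 1} else if b = 1 then {..<r + 1} \<union> {2 * r + 1..<3 * r + 1}
         else if b = 2 then {r + 1..<3 * r + 2}
         else if b = 3 then {2 * r + 1..<3 * r + 1} \<union> {3 * r + 2..<4 * r + 3}
         else {2 * r + 1..<4 * r + 3} - {2 * r + 1 + (b - 4)})
    (\<lambda>b. if b = 0 then 2 * r else if b \<le> 3 then 1 else 2)"
    (is "balanced_design _ _ _ ?blk ?w")
proof -
  have "(\<Sum>b<r + 4. if n \<in> ?blk b then ?w b else 0) = 2 * r + 1" if "n < 4 * r + 3" for n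
  proof -
    have 1: "(\<Sum>b<r + 4. f b) = f 0 + f 1 + f 2 + f 3 + (\<Sum>i<r. f (i + 4))" for f :: "nat \<Rightarrow> nat"
    proof -
      have "r + 4 = Suc (Suc (Suc (Suc r)))" by simp
      then show ?thesis
        unfolding \<open>r + 4 = _\<close> sum.lessThan_Suc_shift
        by (simp add: numeral_2_eq_2 numeral_3_eq_3 eval_nat_numeral)
    qed
    have "(\<Sum>i<r. if n \<in> ?blk (i + 4) then ?w (i + 4) else 0) =
        (\<Sum>i<r. if n \<in> {2 * r + 1..<4 * r + 3} - {2 * r + 1 + i} then 2 else 0)"
      by (intro sum.cong) auto
    also have "\<dots> = (if n < 2 * r + 1 then 0 else if n < 3 * r + 1 then 2 * (r - 1) else 2 * r)"
      using that by (subst sum_punctured_interval) auto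
    finally have 2: "(\<Sum>i<r. if n \<in> ?blk (i + 4) then ?w (i + 4) else 0) = \<dots>" .
    \<comment> \<open>The loads are, in this order, \<open>2 * r + 1\<close> with block 1, the same
      with block 2, \<open>3 + 2 * (r - 1)\<close>, and \<open>1 + 2 * r\<close> with block 2 for
      the single point \<open>3 * r + 1\<close> and with block 3 for the last points.\<close>
    consider "n < r + 1" | "r + 1 \<le> n" "n < 2 * r + 1" | "2 * r + 1 \<le> n" "n < 3 * r + 1"
      | "n = 3 * r + 1" | "3 * r + 2 \<le> n"
      by linarith
    then show ?thesis
      unfolding 1 2 using assms that by cases simp_all
  qed
  moreover have "?blk b \<subseteq> {..<4 * r + 3} \<and> card (?blk b) = 2 * r + 1 \<and> 0 < ?w b" if "b < r + 4" for b
  proof -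
    have card1: "card ({..<r + 1} \<union> {2 * r + 1..<3 * r + 1}) = 2 * r + 1"
      by (subst card_Un_disjoint) auto
    have card2: "card ({2 * r + 1..<3 * r + 1} \<union> {3 * r + 2..<4 * r + 3}) = 2 * r + 1"
      by (subst card_Un_disjoint) auto
    have card3: "card ({2 * r + 1..<4 * r + 3} - {2 * r + 1 + (b - 4)}) = 2 * r + 1" if "4 \<le> b"
      using that \<open>b < r + 4\<close> by (subst card_Diff_singleton) auto
    consider "b = 0" | "b = 1" | "b = 2" | "b = 3" | "4 \<le> b" by linarith
    then show ?thesis
    proof cases
      case 2
      then show ?thesis using card1 by auto
    next
      case 4
      then show ?thesis using card2 by auto
    next
      case 5
      then show ?thesis using card3 by auto
    qed (use assms in auto)
  qed
  ultimately show ?thesis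
    unfolding balanced_design_def by blast
qed

text \<open>For \<open>r = m div 2\<close> the even construction has \<open>r + 3\<close> blocks and
  the odd one \<open>r + 4\<close>, which is \<open>(m + 1) div 2 + 3\<close> in both cases;
  \<open>m \<ge> 2\<close> ensures \<open>r \<ge> 1\<close>.\<close>

lemma balanced_design_base:
  assumes "m \<ge> 2"
  shows "\<exists>blk w. balanced_design (2 * m + 1) m ((m + 1) div 2 + 3) blk w"
proof (cases "even m")
  case True
  then obtain r where "m = 2 * r" ..
  then show ?thesis
    using balanced_design_even[of r] assms by auto
next
  case False
  then obtain r where "m = 2 * r + 1" by (rule oddE)
  then have eq: "2 * m + 1 = 4 * r + 3" "(m + 1) div 2 + 3 = r + 4"
    by simp_all
  have "r \<ge> 1"
    using assms \<open>m = 2 * r + 1\<close> by simp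
  from balanced_design_odd[OF this] show ?thesis
    unfolding eq unfolding \<open>m = 2 * r + 1\<close> by blast
qed

section \<open>Designs and schemes for \<open>N = d * M + 1\<close> and
  \<open>N = d * M - 1\<close>\<close>

text \<open>The base design covers \<open>d = 2\<close>; each further multiple of \<open>M\<close>
  adds one disjoint block.\<close>

lemma balanced_design_exists_plus:
  assumes "M \<ge> 3" "d \<ge> 2"
  shows "\<exists>blk w. balanced_design (d * M + 1) M (d + (M + 1) div 2 + 1) blk w"
proof -
  obtain e where d: "d = e + 2"
    using \<open>d \<ge> 2\<close> le_Suc_ex by (metis add.commute)
  obtain blk w where "balanced_design (2 * M + 1) M ((M + 1) div 2 + 3) blk w"
    using balanced_design_base[of M] assms(1) by auto
  then have "\<exists>blk w. balanced_design (2 * M + 1 + e * M) M ((M + 1) div 2 + 3 + e) blk w"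
    by (rule balanced_design_extend_many) (use assms in simp)
  moreover have "2 * M + 1 + e * M = d * M + 1" "(M + 1) div 2 + 3 + e = d + (M + 1) div 2 + 1"
    using d by (simp_all add: algebra_simps)
  ultimately show ?thesis
    by metis
qed

text \<open>The base design with blocks of size \<open>M - 1\<close> has \<open>2 * M - 1\<close>
  points, so the complements of its blocks have size \<open>M\<close>. This covers
  \<open>d = 2\<close> with \<open>M div 2 + 3\<close> blocks, and disjoint blocks do the
  rest.\<close>

lemma balanced_design_exists_minus:
  assumes "M \<ge> 3" "d \<ge> 2"
  shows "\<exists>blk w. balanced_design (d * M - 1) M (d + M div 2 + 1) blk w"
proof -
  obtain e where d: "d = e + 2"
    using \<open>d \<ge> 2\<close> le_Suc_ex by (metis add.commute)
  obtain blk w where "balanced_design (2 * (M - 1) + 1) (M - 1) ((M - 1 + 1) div 2 + 3) blk w"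
    using balanced_design_base[of "M - 1"] assms(1) by fastforce
  moreover have "2 * (M - 1) + 1 = 2 * M - 1" "(M - 1 + 1) div 2 + 3 = M div 2 + 3"
    using assms(1) by simp_all
  ultimately have "balanced_design (2 * M - 1) (M - 1) (M div 2 + 3) blk w"
    by simp
  from balanced_design_complement[OF this]
  have "balanced_design (2 * M - 1) (2 * M - 1 - (M - 1)) (M div 2 + 3) (\<lambda>b. {..<2 * M - 1} - blk b) w"
    using assms(1) by simp
  moreover have "2 * M - 1 - (M - 1) = M"
    using assms(1) by simp
  ultimately have "balanced_design (2 * M - 1) M (M div 2 + 3) (\<lambda>b. {..<2 * M - 1} - blk b) w"
    by metis
  then have "\<exists>blk w. balanced_design (2 * M - 1 + e * M) M (M div 2 + 3 + e) blk w"
    by (rule balanced_design_extend_many) (use assms in simp)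
  moreover have "2 * M - 1 + e * M = d * M - 1" "M div 2 + 3 + e = d + M div 2 + 1"
    using d assms(1) by (simp_all add: algebra_simps)
  ultimately show ?thesis
    by metis
qed

text \<open>Vertices become servers by \<open>Suc\<close>; the positions within a block are an
  arbitrary numbering.\<close>

lemma scheme_from_design:
  assumes design: "balanced_design N M B blk w" and "1 \<le> K" "2 \<le> M" "1 \<le> N"
  shows "\<exists>S :: 'f::{finite,field} linear_pir_scheme.
    sc_pir_scheme (real M / real N) N K S \<and> linear_scheme N K S \<and> capacity_achieving M N K S \<and>
    subpacketization S = B * (M - 1)"
proof -
  define blk' where "blk' b = Suc ` blk b" for b
  have "\<exists>p. bij_betw p (blk' b) {..<M}" if "b < B" for b
  proof -
    have "finite (blk b)" "card (blk b) = M"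
      using design that finite_subset[of "blk b" "{..<N}"] by (auto simp: balanced_design_def)
    then have "finite (blk' b)" "card (blk' b) = M"
      by (simp_all add: blk'_def card_image)
    then show ?thesis
      using ex_bij_betw_finite_nat[of "blk' b"] by (simp add: atLeast0LessThan)
  qed
  then obtain pos where pos: "\<And>b. b < B \<Longrightarrow> bij_betw (pos b) (blk' b) {..<M}"
    by metis
  have mem: "Suc n \<in> blk' b \<longleftrightarrow> n \<in> blk b" for n b
    by (auto simp: blk'_def)
  interpret block_code N M K B blk' w pos
  proof
    show "(\<Sum>b<B. if n \<in> blk' b then w b else 0) = M" if "n \<in> {1..N}" for n
      using that design by (cases n) (auto simp: mem balanced_design_def)
    show "(\<Sum>b<B. w b) = N"
      using balanced_design_weight[OF design] assms by simp
    show "blk' b \<subseteq> {1..N}" if "b < B" for b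
      using design that by (auto simp: blk'_def balanced_design_def Suc_le_eq subset_iff)
    show "0 < w b" if "b < B" for b
      using design that by (simp add: balanced_design_def)
  qed (use assms pos in auto)
  show ?thesis
    using scheme_valid scheme_linear scheme_capacity by (intro exI[of _ scheme]) (simp add: F_def)
qed

theorem corollary3:
  fixes N K M d :: nat
  assumes "K \<ge> 1" and "3 \<le> M" and "M \<le> N" and "d \<ge> 2"
    and "N = d * M + 1 \<or> N = d * M - 1"
  shows "\<exists>S :: ('f::{finite,field}) linear_pir_scheme.
           sc_pir_scheme (real M / real N) N K S \<and>
           linear_scheme N K S \<and>
           capacity_achieving M N K S \<and>
           (N = d * M + 1 \<longrightarrow>
              subpacketization S = (d + nat \<lceil>real M / 2\<rceil> + 1) * (M - 1)) \<and>
           (N = d * M - 1 \<longrightarrow>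
              subpacketization S = (d + nat \<lfloor>real M / 2\<rfloor> + 1) * (M - 1))"
proof -
  have floor: "nat \<lfloor>real M / 2\<rfloor> = M div 2"
    by (metis floor_divide_of_nat_eq nat_int of_nat_numeral)
  have ceiling: "nat \<lceil>real M / 2\<rceil> = (M + 1) div 2"
  proof (cases "even M")
    case True
    then obtain m where "M = 2 * m" ..
    then show ?thesis by simp
  next
    case False
    then obtain m where "M = 2 * m + 1" by (rule oddE)
    moreover from this have "\<lceil>real M / 2\<rceil> = int m + 1"
      by (intro ceiling_unique) auto
    ultimately show ?thesis by simp
  qed
  have code: "\<exists>S :: 'f linear_pir_scheme. sc_pir_scheme (real M / real N) N K S \<and>
      linear_scheme N K S \<and> capacity_achieving M N K S \<and> subpacketization S = B * (M - 1)"
    if "balanced_design N M B blk w" for B blk w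
    using that by (rule scheme_from_design) (use assms in simp_all)
  show ?thesis
    using assms(5)
  proof
    assume N: "N = d * M + 1"
    obtain blk w where "balanced_design N M (d + (M + 1) div 2 + 1) blk w"
      using balanced_design_exists_plus[OF \<open>3 \<le> M\<close> \<open>d \<ge> 2\<close>] N by blast
    \<comment> \<open>The two cases exclude each other, so the implication for the other one holds
      vacuously.\<close>
    moreover have "N \<noteq> d * M - 1" using N by simp
    ultimately show ?thesis
      unfolding floor ceiling using code by blast
  next
    assume N: "N = d * M - 1"
    obtain blk w where "balanced_design N M (d + M div 2 + 1) blk w"
      using balanced_design_exists_minus[OF \<open>3 \<le> M\<close> \<open>d \<ge> 2\<close>] N by blast
    moreover have "N \<noteq> d * M + 1" using N by simp
    ultimately show ?thesis
      unfolding floor ceiling using code by blast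
  qed
qed

end
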